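(* Let $b,c,d$ be smooth functions with $b\ge\beta^2>0$ and $c-\tfrac12\|d\|_{L^\infty(1,2)}-\tfrac{1}{2\beta^2}\|b'\|_{L^\infty(0,2)}^2\ge\delta>0$, let $f$ be a given function on $(0,2)$, and let $\Phi$ be a given function on $(-1,0)$ with $\Phi(0)=0$ and $\Phi'(0)=0$. Consider the system $$\varepsilon^2u_1^{(4)}(x)-b(x)u_1''(x)+c(x)u_1(x)=f(x)-d(x)\Phi(x-1),\quad x\in(0,1),$$ $$\varepsilon^2u_2^{(4)}(x)-b(x)u_2''(x)+c(x)u_2(x)=f(x)-d(x)u_1(x-1),\quad x\in(1,2),$$ together with the conditions $$u_1(0)=\alpha_1,\quad u_1(1)=\alpha_2,\quad u_2(1)=\alpha_2+\delta_1,\quad u_2(2)=\alpha_3,$$ $$u_1'(0)=\beta_1,\quad u_1'(1)=\beta_2,\quad u_2'(1)=\beta_2+\delta_2,\quad u_2'(2)=\beta_3,$$ where $\alpha_1,\alpha_3,\beta_1,\beta_3,\delta_1,\delta_2$ are given parameters and $\alpha_2,\beta_2$ are chosen such that $u_2''(1)-u_1''(1)=0$ and $u_2'''(1)-u_1'''(1)=0$. Let $u=u_1\chi_{[0,1)}+u_2\chi_{[1,2]}$. Then it follows that $$\|u\|_{L^\infty(0,2)}\lesssim\|f\|_{L^\infty(0,2)}+|\alpha_1|+|\alpha_3|+|\delta_1|+|\delta_2|+|\beta_1|+|\beta_3|.$$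
   Context: $\varepsilon>0$ is a small singular perturbation parameter. $A\lesssim B$ means $A\le CB$ with a generic constant $C$ independent of $\varepsilon$. $\chi_D$ is the indicator function of $D$. Values and derivatives of $u_1$ and $u_2$ at $x=1$ are one-sided limits from within $(0,1)$ and $(1,2)$, respectively. The function $\Phi$ is the prescribed history of the underlying shift problem ($u=\Phi$ on $(-1,0)$).
   Formalization: The bound proved has the extra term ‖Φ‖_{L^∞(-1,0)} on the right, with Φ bounded; without it the claim fails, e.g. f=0, all parameters 0, d=0 on (1,2), u_1 a bump where d≠0 in (0,1), u_2=0, and Φ read off from the first equation. *)

theory Defs
  imports "HOL-Analysis.Analysis" "HOL-Probability.Essential_Supremum"
begin

text \<open>Infinitely differentiable on \<open>S\<close>: \<open>D k\<close> is the \<open>k\<close>-th derivative, and derivatives are taken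
  within \<open>S\<close>, hence one-sided at the endpoints of a closed interval.\<close>

definition smooth_on :: "real set \<Rightarrow> (real \<Rightarrow> real) \<Rightarrow> bool" where
  "smooth_on S g \<longleftrightarrow>
     (\<exists>D :: nat \<Rightarrow> real \<Rightarrow> real. (\<forall>x\<in>S. D 0 x = g x) \<and>
        (\<forall>k. \<forall>x\<in>S. (D k has_real_derivative D (Suc k) x) (at x within S)))"

definition in_Linf :: "real set \<Rightarrow> (real \<Rightarrow> real) \<Rightarrow> bool" where
  "in_Linf S g \<longleftrightarrow> g \<in> borel_measurable (lebesgue_on S) \<and>
     esssup (lebesgue_on S) (\<lambda>x. ereal \<bar>g x\<bar>) < \<infinity>"

text \<open>Meaningful only together with \<open>in_Linf S g\<close> (and \<open>S\<close> of positive measure), since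
  \<open>real_of_ereal\<close> sends infinite values to \<open>0\<close>.\<close>

definition Linf_norm :: "real set \<Rightarrow> (real \<Rightarrow> real) \<Rightarrow> real" where
  "Linf_norm S g = real_of_ereal (esssup (lebesgue_on S) (\<lambda>x. ereal \<bar>g x\<bar>))"

abbreviation nderiv :: "nat \<Rightarrow> (real \<Rightarrow> real) \<Rightarrow> real \<Rightarrow> real" where
  "nderiv k g \<equiv> (deriv ^^ k) g"

text \<open>Needed beside the differential equation because \<open>deriv\<close> is total: without it, \<open>nderiv 4 g x\<close>
  could be a meaningless value.\<close>

definition four_times_differentiable_on :: "real set \<Rightarrow> (real \<Rightarrow> real) \<Rightarrow> bool" where
  "four_times_differentiable_on S g \<longleftrightarrow> (\<forall>k<4. \<forall>x\<in>S. nderiv k g differentiable (at x))"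

definition solves_shift_system ::
  "real \<Rightarrow> (real \<Rightarrow> real) \<Rightarrow> (real \<Rightarrow> real) \<Rightarrow> (real \<Rightarrow> real) \<Rightarrow> (real \<Rightarrow> real) \<Rightarrow> (real \<Rightarrow> real) \<Rightarrow>
   (real \<Rightarrow> real) \<Rightarrow> (real \<Rightarrow> real) \<Rightarrow> bool" where
  "solves_shift_system \<epsilon> b c d f \<Phi> u\<^sub>1 u\<^sub>2 \<longleftrightarrow>
     four_times_differentiable_on {0<..<1} u\<^sub>1 \<and>
     four_times_differentiable_on {1<..<2} u\<^sub>2 \<and>
     (\<forall>x\<in>{0<..<1}. \<epsilon>\<^sup>2 * nderiv 4 u\<^sub>1 x - b x * nderiv 2 u\<^sub>1 x + c x * u\<^sub>1 x
                     = f x - d x * \<Phi> (x - 1)) \<and>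
     (\<forall>x\<in>{1<..<2}. \<epsilon>\<^sup>2 * nderiv 4 u\<^sub>2 x - b x * nderiv 2 u\<^sub>2 x + c x * u\<^sub>2 x
                     = f x - d x * u\<^sub>1 (x - 1))"

text \<open>All values and derivatives at \<open>0\<close>, \<open>1\<close> and \<open>2\<close> are one-sided limits from within the interval
  on which the respective function solves its equation.\<close>

definition boundary_conditions ::
  "real \<Rightarrow> real \<Rightarrow> real \<Rightarrow> real \<Rightarrow> real \<Rightarrow> real \<Rightarrow> real \<Rightarrow> real \<Rightarrow>
   (real \<Rightarrow> real) \<Rightarrow> (real \<Rightarrow> real) \<Rightarrow> bool" where
  "boundary_conditions \<alpha>\<^sub>1 \<alpha>\<^sub>2 \<alpha>\<^sub>3 \<beta>\<^sub>1 \<beta>\<^sub>2 \<beta>\<^sub>3 \<delta>\<^sub>1 \<delta>\<^sub>2 u\<^sub>1 u\<^sub>2 \<longleftrightarrow>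
     (u\<^sub>1 \<longlongrightarrow> \<alpha>\<^sub>1) (at_right 0) \<and> (u\<^sub>1 \<longlongrightarrow> \<alpha>\<^sub>2) (at_left 1) \<and>
     (u\<^sub>2 \<longlongrightarrow> \<alpha>\<^sub>2 + \<delta>\<^sub>1) (at_right 1) \<and> (u\<^sub>2 \<longlongrightarrow> \<alpha>\<^sub>3) (at_left 2) \<and>
     (deriv u\<^sub>1 \<longlongrightarrow> \<beta>\<^sub>1) (at_right 0) \<and> (deriv u\<^sub>1 \<longlongrightarrow> \<beta>\<^sub>2) (at_left 1) \<and>
     (deriv u\<^sub>2 \<longlongrightarrow> \<beta>\<^sub>2 + \<delta>\<^sub>2) (at_right 1) \<and> (deriv u\<^sub>2 \<longlongrightarrow> \<beta>\<^sub>3) (at_left 2)"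

definition matching_conditions :: "(real \<Rightarrow> real) \<Rightarrow> (real \<Rightarrow> real) \<Rightarrow> bool" where
  "matching_conditions u\<^sub>1 u\<^sub>2 \<longleftrightarrow>
     (\<forall>k\<in>{2, 3}. \<exists>p q. (nderiv k u\<^sub>1 \<longlongrightarrow> p) (at_left 1) \<and>
                         (nderiv k u\<^sub>2 \<longlongrightarrow> q) (at_right 1) \<and> q - p = 0)"

definition glue :: "(real \<Rightarrow> real) \<Rightarrow> (real \<Rightarrow> real) \<Rightarrow> real \<Rightarrow> real" where
  "glue u\<^sub>1 u\<^sub>2 x = u\<^sub>1 x * indicator {0..<1} x + u\<^sub>2 x * indicator {1..2} x"

text \<open>A history satisfies \<open>\<Phi>(0) = \<Phi>'(0) = 0\<close>, the derivative at \<open>0\<close> being taken from the left.\<close>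

definition admissible_history :: "(real \<Rightarrow> real) \<Rightarrow> bool" where
  "admissible_history \<Phi> \<longleftrightarrow>
     in_Linf {-1<..<0} \<Phi> \<and> \<Phi> 0 = 0 \<and> (\<Phi> has_real_derivative 0) (at_left 0)"

text \<open>A norm of \<open>\<Phi>\<close> is indispensable in an a priori bound of \<open>glue u\<^sub>1 u\<^sub>2\<close> by the data. Without it the bound
  fails: let \<open>f\<close> and all parameters vanish, let \<open>d\<close> vanish on \<open>(1,2)\<close> and be nonzero on a compact interval \<open>I\<close> in
  \<open>(0,1)\<close>, let \<open>u\<^sub>1 \<noteq> 0\<close> be a smooth bump supported in \<open>I\<close>, put \<open>u\<^sub>2 = 0\<close>, and read off \<open>\<Phi>\<close> from the
  first equation (\<open>\<Phi>(x - 1) = 0\<close> for \<open>x\<close> outside \<open>I\<close>).\<close>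

end

theory Submission
  imports Defs
begin

text \<open>The data are lifted by a cubic \<open>w\<close> on \<open>(0,1)\<close> and by \<open>w + \<delta>\<^sub>1 + \<delta>\<^sub>2 (x - 1)\<close> on \<open>(1,2)\<close>: both have
  vanishing fourth derivative, so the lifting creates no term in \<open>\<epsilon>\<close>, and adding an affine function
  keeps the second and third derivatives matched at \<open>1\<close>. The remainders \<open>p\<close> on \<open>(0,1)\<close> and \<open>q\<close> on
  \<open>(1,2)\<close>, the latter shifted to \<open>(0,1)\<close>, have homogeneous outer data and fit together at \<open>1\<close>. Put
  \<open>G y = \<epsilon>\<^sup>2 (y y''' - y' y'') - b y y'\<close>. Testing the equations with \<open>p\<close> and \<open>q\<close> gives, almost everywhere,
  \<open>(G p + G q)' \<le> M\<^sup>2 / \<delta> - \<kappa> (p\<^sup>2 + p'\<^sup>2 + q\<^sup>2 + q'\<^sup>2)\<close>, and \<open>G p + G q\<close> has the same limit at both ends.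
  Since \<open>\<kappa> (p\<^sup>2)'\<close> and \<open>-\<kappa> (q\<^sup>2)'\<close> are dominated by the dissipated quantity, \<open>\<kappa> p\<^sup>2\<close> and \<open>\<kappa> q\<^sup>2\<close> are at most
  \<open>M\<^sup>2 / \<delta>\<close>.\<close>

section \<open>Bounds from almost everywhere information on a derivative\<close>

text \<open>The data are only essentially bounded, so the highest derivatives are controlled only
  off a negligible set. The gauge integral recovers \<open>f\<close> from a derivative that exists
  everywhere, continuous or not, and ignores negligible sets.\<close>

lemma increment_le_AE_derivative_bound:
  fixes f f' :: "real \<Rightarrow> real"
  assumes "negligible N" and "a \<le> b"
    and f': "\<And>x. x \<in> {a..b} \<Longrightarrow> (f has_real_derivative f' x) (at x)"
    and le: "\<And>x. x \<in> {a..b} - N \<Longrightarrow> f' x \<le> k"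
  shows "f b - f a \<le> k * (b - a)"
proof -
  have "(f' has_integral f b - f a) {a..b}"
    using assms(2) f'
    by (intro fundamental_theorem_of_calculus)
       (auto simp: has_real_derivative_iff_has_vector_derivative[symmetric]
             intro: has_field_derivative_at_within)
  \<comment> \<open>On \<open>N\<close> the derivative is replaced by \<open>k\<close>, so that the
    comparison with the constant holds at every point.\<close>
  then have "((\<lambda>x. if x \<in> N then k else f' x) has_integral f b - f a) {a..b}"
    by (rule has_integral_spike[OF assms(1), rotated]) auto
  moreover have "((\<lambda>_. k) has_integral k * (b - a)) {a..b}"
    using has_integral_const_real[of k a b] assms(2) by (simp add: mult.commute)
  ultimately show ?thesis
    by (rule has_integral_le) (use le in auto)
qed

text \<open>An essentially bounded derivative makes \<open>f\<close> Lipschitz, and comparison with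
  the value at the midpoint gives a bound up to the endpoints, where nothing is known about
  \<open>f\<close>.\<close>

lemma bounded_AE_derivative_bound:
  fixes f f' :: "real \<Rightarrow> real"
  assumes "negligible N"
    and f': "\<And>x. x \<in> {a<..<b} \<Longrightarrow> (f has_real_derivative f' x) (at x)"
    and bd: "\<And>x. x \<in> {a<..<b} - N \<Longrightarrow> \<bar>f' x\<bar> \<le> K"
  shows "\<exists>K'. \<forall>x\<in>{a<..<b}. \<bar>f x\<bar> \<le> K'"
proof -
  have lip: "\<bar>f y - f x\<bar> \<le> \<bar>K\<bar> * (b - a)" if "x \<in> {a<..<b}" "y \<in> {a<..<b}" "x \<le> y" for x y
  proof -
    have "f y - f x \<le> \<bar>K\<bar> * (y - x)"
    proof (rule increment_le_AE_derivative_bound[OF assms(1) \<open>x \<le> y\<close>])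
      show "f' z \<le> \<bar>K\<bar>" if "z \<in> {x..y} - N" for z
        using bd[of z] that \<open>x \<in> _\<close> \<open>y \<in> _\<close> by auto
    qed (use f' that in auto)
    moreover have "(- f y) - (- f x) \<le> \<bar>K\<bar> * (y - x)"
    proof (rule increment_le_AE_derivative_bound[OF assms(1) \<open>x \<le> y\<close>, of "\<lambda>z. - f z" "\<lambda>z. - f' z"])
      show "- f' z \<le> \<bar>K\<bar>" if "z \<in> {x..y} - N" for z
        using bd[of z] that \<open>x \<in> _\<close> \<open>y \<in> _\<close> by auto
    qed (use f' that in \<open>auto intro!: DERIV_minus\<close>)
    moreover have "\<bar>K\<bar> * (y - x) \<le> \<bar>K\<bar> * (b - a)"
      using that by (intro mult_left_mono) auto
    ultimately show ?thesis by linarith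
  qed
  define m where "m = (a + b) / 2"
  have "\<bar>f x\<bar> \<le> \<bar>f m\<bar> + \<bar>K\<bar> * (b - a)" if "x \<in> {a<..<b}" for x
  proof -
    have m: "m \<in> {a<..<b}" using that by (auto simp: m_def)
    show ?thesis
      using lip[OF that m] lip[OF m that] by linarith
  qed
  then show ?thesis by blast
qed

text \<open>The one-sided limits extend \<open>f\<close> continuously to a compact interval.\<close>

lemma bounded_open_interval:
  fixes f :: "real \<Rightarrow> real"
  assumes "continuous_on {a<..<b} f"
    and "(f \<longlongrightarrow> l) (at_right a)" and "(f \<longlongrightarrow> r) (at_left b)"
  shows "\<exists>K. \<forall>x\<in>{a<..<b}. \<bar>f x\<bar> \<le> K"
proof (cases "a < b")
  case True
  define g where "g x = (if x \<le> a then l else if x \<ge> b then r else f x)" for x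
  have eq: "g x = f x" if "x \<in> {a<..<b}" for x
    using that by (simp add: g_def)
  have "continuous_on {a..b} g"
  proof (rule continuous_on_IccI)
    have "\<forall>\<^sub>F x in at_right a. x \<in> {a<..<b}"
      using True by (rule eventually_at_right_real)
    then have "\<forall>\<^sub>F x in at_right a. f x = g x"
      by (rule eventually_mono) (simp add: eq)
    moreover have "g a = l" by (simp add: g_def)
    ultimately show "(g \<longlongrightarrow> g a) (at_right a)"
      using Lim_transform_eventually[OF assms(2)] by simp
    have "\<forall>\<^sub>F x in at_left b. x \<in> {a<..<b}"
      using True by (rule eventually_at_left_real)
    then have "\<forall>\<^sub>F x in at_left b. f x = g x"
      by (rule eventually_mono) (simp add: eq)
    moreover have "g b = r" using True by (simp add: g_def)
    ultimately show "(g \<longlongrightarrow> g b) (at_left b)"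
      using Lim_transform_eventually[OF assms(3)] by simp
    show "g \<midarrow>x\<rightarrow> g x" if "a < x" "x < b" for x
    proof -
      have x: "x \<in> {a<..<b}" using that by simp
      have "(f \<longlongrightarrow> f x) (at x)"
        using assms(1) x continuous_on_eq_continuous_at[OF open_greaterThanLessThan] isCont_def by blast
      moreover have "\<forall>\<^sub>F z in at x. f z = g z"
        by (rule eventually_mono[OF eventually_at_in_open'[OF open_greaterThanLessThan x]]) (simp add: eq)
      ultimately show ?thesis using eq[OF x] Lim_transform_eventually by metis
    qed
  qed (rule True)
  then have "bounded (g ` {a..b})"
    by (intro compact_imp_bounded compact_continuous_image) auto
  then obtain K where "\<And>x. x \<in> {a..b} \<Longrightarrow> \<bar>g x\<bar> \<le> K"
    unfolding bounded_iff by (metis image_eqI real_norm_def)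
  then have "\<And>x. x \<in> {a<..<b} \<Longrightarrow> \<bar>f x\<bar> \<le> K"
    using eq by (metis atLeastAtMost_iff greaterThanLessThan_iff less_imp_le)
  then show ?thesis by blast
qed auto

text \<open>Only \<open>y\<close> and \<open>y'\<close> are prescribed at the outer endpoints. The higher derivatives are controlled there
  because \<open>(e y''' - b y')' = e y'''' - b y'' - b' y'\<close> is essentially bounded.\<close>

lemma bounded_second_third_derivative:
  fixes y :: "nat \<Rightarrow> real \<Rightarrow> real" and b b' :: "real \<Rightarrow> real"
  assumes "negligible N" and "e > 0"
    and y: "\<And>k x. k < 4 \<Longrightarrow> x \<in> {l<..<r} \<Longrightarrow> (y k has_real_derivative y (Suc k) x) (at x)"
    and b': "\<And>x. x \<in> {l<..<r} \<Longrightarrow> (b has_real_derivative b' x) (at x)"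
    and b_le: "\<And>x. x \<in> {l<..<r} \<Longrightarrow> \<bar>b x\<bar> \<le> B"
    and b'_le: "\<And>x. x \<in> {l<..<r} - N \<Longrightarrow> \<bar>b' x\<bar> \<le> B'"
    and y1_le: "\<And>x. x \<in> {l<..<r} \<Longrightarrow> \<bar>y 1 x\<bar> \<le> K"
    and eq_le: "\<And>x. x \<in> {l<..<r} - N \<Longrightarrow> \<bar>e * y 4 x - b x * y 2 x\<bar> \<le> M"
  shows "\<exists>K'. \<forall>x\<in>{l<..<r}. \<bar>y 2 x\<bar> \<le> K' \<and> \<bar>y 3 x\<bar> \<le> K'"
proof -
  have y23: "(y 1 has_real_derivative y 2 x) (at x)" "(y 2 has_real_derivative y 3 x) (at x)"
    "(y 3 has_real_derivative y 4 x) (at x)" if "x \<in> {l<..<r}" for x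
    using y[of 1 x] y[of 2 x] y[of 3 x] that by (simp_all add: eval_nat_numeral)
  define H where "H x = e * y 3 x - b x * y 1 x" for x
  have "\<exists>K'. \<forall>x\<in>{l<..<r}. \<bar>H x\<bar> \<le> K'"
  proof (rule bounded_AE_derivative_bound[OF assms(1)])
    show "(H has_real_derivative e * y 4 x - b x * y 2 x - b' x * y 1 x) (at x)"
      if "x \<in> {l<..<r}" for x
      unfolding H_def using y23[OF that] b'[OF that]
      by (auto intro!: derivative_eq_intros)
    show "\<bar>e * y 4 x - b x * y 2 x - b' x * y 1 x\<bar> \<le> M + B' * K"
      if "x \<in> {l<..<r} - N" for x
    proof -
      have "\<bar>b' x * y 1 x\<bar> \<le> B' * K"
        unfolding abs_mult using b'_le[OF that] y1_le[of x] that by (intro mult_mono) auto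
      with eq_le[OF that] show ?thesis by linarith
    qed
  qed
  then obtain K3 where K3: "\<And>x. x \<in> {l<..<r} \<Longrightarrow> \<bar>H x\<bar> \<le> K3" by blast
  \<comment> \<open>The factor \<open>1 / e\<close> is harmless: the bound serves only to make
    boundary terms vanish and never reaches the final estimate.\<close>
  have y3: "\<bar>y 3 x\<bar> \<le> (K3 + B * K) / e" if "x \<in> {l<..<r}" for x
  proof -
    have "\<bar>b x * y 1 x\<bar> \<le> B * K"
      unfolding abs_mult using b_le[OF that] y1_le[OF that] by (intro mult_mono) auto
    then have "\<bar>e * y 3 x\<bar> \<le> K3 + B * K"
      using K3[OF that] unfolding H_def by linarith
    then show ?thesis using \<open>e > 0\<close> by (simp add: abs_mult field_simps)
  qed
  moreover have "\<exists>K'. \<forall>x\<in>{l<..<r}. \<bar>y 2 x\<bar> \<le> K'"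
    by (rule bounded_AE_derivative_bound[OF negligible_empty y23(2)]) (use y3 in auto)
  then obtain K2 where "\<And>x. x \<in> {l<..<r} \<Longrightarrow> \<bar>y 2 x\<bar> \<le> K2" by blast
  ultimately show ?thesis
    by (intro exI[of _ "max K2 ((K3 + B * K) / e)"]) (auto simp: le_max_iff_disj)
qed

section \<open>The energy estimate\<close>

text \<open>The left side is the derivative of \<open>e (y y''' - y' y'') - b y y'\<close> at a
  point, where \<open>y0\<close>, ..., \<open>y4\<close> stand for \<open>y\<close> and its
  derivatives. The mixed term with \<open>b'\<close> has no sign; completing a square trades it for
  half of \<open>B * y1\<^sup>2\<close> and for \<open>L\<^sup>2 / (2 * B) * y0\<^sup>2\<close>,
  which for \<open>B = \<beta>\<^sup>2\<close> is the term subtracted from \<open>c\<close> in the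
  theorem.\<close>

lemma energy_dissipation:
  fixes B :: real
  assumes "e \<ge> 0" and "b \<ge> B" and "B > 0" and "\<bar>b'\<bar> \<le> L"
  shows "e * (y0 * y4 - y2\<^sup>2) - b' * y0 * y1 - b * y1\<^sup>2 - b * y0 * y2
    \<le> y0 * (e * y4 - b * y2) + L\<^sup>2 / (2 * B) * y0\<^sup>2 - B / 2 * y1\<^sup>2"
proof -
  have "0 \<le> (B * y1 + b' * y0)\<^sup>2 / (2 * B)" using assms by simp
  also have "\<dots> = B / 2 * y1\<^sup>2 + b' * y0 * y1 + b'\<^sup>2 / (2 * B) * y0\<^sup>2"
    using assms(3) by (simp add: power2_eq_square field_simps)
  also have "b'\<^sup>2 / (2 * B) * y0\<^sup>2 \<le> L\<^sup>2 / (2 * B) * y0\<^sup>2"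
    using assms by (intro mult_right_mono divide_right_mono)
      (auto simp: abs_le_square_iff[symmetric])
  finally have "- b' * y0 * y1 \<le> B / 2 * y1\<^sup>2 + L\<^sup>2 / (2 * B) * y0\<^sup>2" by simp
  moreover have "B * y1\<^sup>2 \<le> b * y1\<^sup>2" using assms by (intro mult_right_mono) auto
  moreover have "0 \<le> e * y2\<^sup>2" using assms by simp
  ultimately show ?thesis by (simp add: algebra_simps)
qed

text \<open>Once the second equation is shifted onto the first interval, the delayed term is a
  zero-order coupling \<open>d * p0\<close> at the same point, so the two energy inequalities can be
  added pointwise. The lower bounds on \<open>c1\<close> and \<open>c2\<close> then pay for the
  coupling, for the mixed terms and for the residuals.\<close>

lemma coupled_energy_dissipation:
  fixes \<beta> \<delta> :: real
  assumes "e \<ge> 0" and "\<beta>\<^sup>2 > 0" and "\<delta> > 0"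
    and "b1 \<ge> \<beta>\<^sup>2" and "\<bar>b1'\<bar> \<le> L" and "b2 \<ge> \<beta>\<^sup>2" and "\<bar>b2'\<bar> \<le> L" and "\<bar>d\<bar> \<le> D"
    and c1: "c1 - 1/2 * D - 1 / (2 * \<beta>\<^sup>2) * L\<^sup>2 \<ge> \<delta>"
    and c2: "c2 - 1/2 * D - 1 / (2 * \<beta>\<^sup>2) * L\<^sup>2 \<ge> \<delta>"
    and F1: "\<bar>e * p4 - b1 * p2 + c1 * p0\<bar> \<le> M"
    and F2: "\<bar>e * q4 - b2 * q2 + c2 * q0 + d * p0\<bar> \<le> M"
    and \<kappa>: "\<kappa> \<le> \<delta> / 2" "\<kappa> \<le> \<beta>\<^sup>2 / 2"
  shows "(e * (p0 * p4 - p2\<^sup>2) - b1' * p0 * p1 - b1 * p1\<^sup>2 - b1 * p0 * p2)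
    + (e * (q0 * q4 - q2\<^sup>2) - b2' * q0 * q1 - b2 * q1\<^sup>2 - b2 * q0 * q2)
    \<le> M\<^sup>2 / \<delta> - \<kappa> * (p0\<^sup>2 + p1\<^sup>2 + q0\<^sup>2 + q1\<^sup>2)"
proof -
  \<comment> \<open>The weight \<delta> spends half of the surplus \<delta> in \<open>c1\<close> and
    \<open>c2\<close> on the residuals; the other half is left for \<kappa>.\<close>
  have young: "z * F \<le> M\<^sup>2 / (2 * \<delta>) + \<delta> / 2 * z\<^sup>2" if "\<bar>F\<bar> \<le> M" for z F
  proof -
    have "0 \<le> (\<delta> * z - F)\<^sup>2 / (2 * \<delta>)" using \<open>\<delta> > 0\<close> by simp
    also have "\<dots> = F\<^sup>2 / (2 * \<delta>) + \<delta> / 2 * z\<^sup>2 - z * F"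
      using \<open>\<delta> > 0\<close> by (simp add: power2_eq_square field_simps)
    also have "F\<^sup>2 / (2 * \<delta>) \<le> M\<^sup>2 / (2 * \<delta>)"
      using that \<open>\<delta> > 0\<close> by (intro divide_right_mono) (auto simp: abs_le_square_iff[symmetric])
    finally show ?thesis by simp
  qed
  \<comment> \<open>The product is charged equally to both unknowns, which is why
    \<open>D / 2\<close> is subtracted from both \<open>c1\<close> and \<open>c2\<close>.\<close>
  have "- (d * p0 * q0) \<le> D / 2 * p0\<^sup>2 + D / 2 * q0\<^sup>2"
  proof -
    have "- (d * p0 * q0) \<le> \<bar>d\<bar> * \<bar>p0 * q0\<bar>"
      by (metis abs_ge_minus_self abs_mult mult.assoc)
    also have "\<dots> \<le> D * ((p0\<^sup>2 + q0\<^sup>2) / 2)"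
    proof (rule mult_mono)
      show "\<bar>p0 * q0\<bar> \<le> (p0\<^sup>2 + q0\<^sup>2) / 2"
        using sum_squares_bound[of "\<bar>p0\<bar>" "\<bar>q0\<bar>"] by (simp add: abs_mult)
    qed (use assms in auto)
    finally show ?thesis by (simp add: field_simps)
  qed
  moreover have "(\<delta> + D / 2 + L\<^sup>2 / (2 * \<beta>\<^sup>2)) * p0\<^sup>2 \<le> c1 * p0\<^sup>2"
    using c1 by (intro mult_right_mono) auto
  moreover have "(\<delta> + D / 2 + L\<^sup>2 / (2 * \<beta>\<^sup>2)) * q0\<^sup>2 \<le> c2 * q0\<^sup>2"
    using c2 by (intro mult_right_mono) auto
  moreover note young[OF F1, of p0] young[OF F2, of q0]
    energy_dissipation[OF \<open>e \<ge> 0\<close> \<open>b1 \<ge> _\<close> \<open>\<beta>\<^sup>2 > 0\<close> \<open>\<bar>b1'\<bar> \<le> _\<close>, of p0 p4 p2 p1]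
    energy_dissipation[OF \<open>e \<ge> 0\<close> \<open>b2 \<ge> _\<close> \<open>\<beta>\<^sup>2 > 0\<close> \<open>\<bar>b2'\<bar> \<le> _\<close>, of q0 q4 q2 q1]
  moreover have "\<kappa> * p0\<^sup>2 \<le> \<delta> / 2 * p0\<^sup>2" "\<kappa> * q0\<^sup>2 \<le> \<delta> / 2 * q0\<^sup>2"
    "\<kappa> * p1\<^sup>2 \<le> \<beta>\<^sup>2 / 2 * p1\<^sup>2" "\<kappa> * q1\<^sup>2 \<le> \<beta>\<^sup>2 / 2 * q1\<^sup>2"
    by (rule mult_right_mono[OF \<kappa>(1) zero_le_power2] mult_right_mono[OF \<kappa>(2) zero_le_power2])+
  moreover have "M\<^sup>2 / \<delta> = M\<^sup>2 / (2 * \<delta>) + M\<^sup>2 / (2 * \<delta>)" by simp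
  ultimately show ?thesis by (simp add: algebra_simps power2_eq_square)
qed

text \<open>The outer conditions are homogeneous, for \<open>p\<close> at 0 and for \<open>q\<close>
  at 1, while \<open>p\<close> at 1 and \<open>q\<close> at 0 share the limits \<open>m\<close> up
  to order three. The interface terms therefore cancel in the sum of the two energies, whatever
  \<open>m\<close> is, and the resulting bound contains neither \<open>e\<close> nor
  \<open>m\<close>.\<close>

lemma energy_estimate:
  fixes p q :: "nat \<Rightarrow> real \<Rightarrow> real" and b1 b1' b2 b2' c1 c2 d :: "real \<Rightarrow> real" and \<beta> \<delta> :: real
  assumes N: "negligible N" and e: "e > 0" and \<beta>: "\<beta>\<^sup>2 > 0" and \<delta>: "\<delta> > 0"
    and p: "\<And>k x. k < 4 \<Longrightarrow> x \<in> {0<..<1} \<Longrightarrow> (p k has_real_derivative p (Suc k) x) (at x)"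
    and q: "\<And>k x. k < 4 \<Longrightarrow> x \<in> {0<..<1} \<Longrightarrow> (q k has_real_derivative q (Suc k) x) (at x)"
    and b1: "\<And>x. x \<in> {0<..<1} \<Longrightarrow> (b1 has_real_derivative b1' x) (at x)"
    and b2: "\<And>x. x \<in> {0<..<1} \<Longrightarrow> (b2 has_real_derivative b2' x) (at x)"
    and b_ge: "\<And>x. x \<in> {0<..<1} \<Longrightarrow> b1 x \<ge> \<beta>\<^sup>2" "\<And>x. x \<in> {0<..<1} \<Longrightarrow> b2 x \<ge> \<beta>\<^sup>2"
    and b_le: "\<And>x. x \<in> {0<..<1} \<Longrightarrow> \<bar>b1 x\<bar> \<le> B" "\<And>x. x \<in> {0<..<1} \<Longrightarrow> \<bar>b2 x\<bar> \<le> B"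
    and c_le: "\<And>x. x \<in> {0<..<1} \<Longrightarrow> \<bar>c1 x\<bar> \<le> C" "\<And>x. x \<in> {0<..<1} \<Longrightarrow> \<bar>c2 x\<bar> \<le> C"
    and b'_le: "\<And>x. x \<in> {0<..<1} - N \<Longrightarrow> \<bar>b1' x\<bar> \<le> L"
      "\<And>x. x \<in> {0<..<1} - N \<Longrightarrow> \<bar>b2' x\<bar> \<le> L"
    and d_le: "\<And>x. x \<in> {0<..<1} - N \<Longrightarrow> \<bar>d x\<bar> \<le> D"
    and c_ge: "\<And>x. x \<in> {0<..<1} \<Longrightarrow> c1 x - 1/2 * D - 1 / (2 * \<beta>\<^sup>2) * L\<^sup>2 \<ge> \<delta>"
      "\<And>x. x \<in> {0<..<1} \<Longrightarrow> c2 x - 1/2 * D - 1 / (2 * \<beta>\<^sup>2) * L\<^sup>2 \<ge> \<delta>"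
    and eq1: "\<And>x. x \<in> {0<..<1} - N \<Longrightarrow> \<bar>e * p 4 x - b1 x * p 2 x + c1 x * p 0 x\<bar> \<le> M"
    and eq2: "\<And>x. x \<in> {0<..<1} - N \<Longrightarrow>
      \<bar>e * q 4 x - b2 x * q 2 x + c2 x * q 0 x + d x * p 0 x\<bar> \<le> M"
    and p_0: "(p 0 \<longlongrightarrow> 0) (at_right 0)" "(p 1 \<longlongrightarrow> 0) (at_right 0)"
    and q_1: "(q 0 \<longlongrightarrow> 0) (at_left 1)" "(q 1 \<longlongrightarrow> 0) (at_left 1)"
    and p_1: "\<And>k. k < 4 \<Longrightarrow> (p k \<longlongrightarrow> m k) (at_left 1)"
    and q_0: "\<And>k. k < 4 \<Longrightarrow> (q k \<longlongrightarrow> m k) (at_right 0)"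
    and b_lim: "(b1 \<longlongrightarrow> bm) (at_left 1)" "(b2 \<longlongrightarrow> bm) (at_right 0)"
    and x: "x \<in> {0<..<1}"
  shows "min (\<delta> / 2) (\<beta>\<^sup>2 / 2) * (p 0 x)\<^sup>2 \<le> M\<^sup>2 / \<delta> \<and>
    min (\<delta> / 2) (\<beta>\<^sup>2 / 2) * (q 0 x)\<^sup>2 \<le> M\<^sup>2 / \<delta>"
proof -
  have dp: "(p 0 has_real_derivative p 1 x) (at x)" "(p 1 has_real_derivative p 2 x) (at x)"
    "(p 2 has_real_derivative p 3 x) (at x)" "(p 3 has_real_derivative p 4 x) (at x)"
    if "x \<in> {0<..<1}" for x
    using p[of 0 x] p[of 1 x] p[of 2 x] p[of 3 x] that by (simp_all add: eval_nat_numeral)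
  have dq: "(q 0 has_real_derivative q 1 x) (at x)" "(q 1 has_real_derivative q 2 x) (at x)"
    "(q 2 has_real_derivative q 3 x) (at x)" "(q 3 has_real_derivative q 4 x) (at x)"
    if "x \<in> {0<..<1}" for x
    using q[of 0 x] q[of 1 x] q[of 2 x] q[of 3 x] that by (simp_all add: eval_nat_numeral)
  define \<kappa> where "\<kappa> = min (\<delta> / 2) (\<beta>\<^sup>2 / 2)"
  have \<kappa>: "\<kappa> \<ge> 0" "\<kappa> \<le> \<delta> / 2" "\<kappa> \<le> \<beta>\<^sup>2 / 2"
    using \<beta> \<delta> by (auto simp: \<kappa>_def)
  define k where "k = M\<^sup>2 / \<delta>"
  define G1 where "G1 x = e * (p 0 x * p 3 x - p 1 x * p 2 x) - b1 x * p 0 x * p 1 x" for x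
  define G2 where "G2 x = e * (q 0 x * q 3 x - q 1 x * q 2 x) - b2 x * q 0 x * q 1 x" for x
  define G where "G x = G1 x + G2 x" for x
  define G' where "G' x =
    (e * (p 0 x * p 4 x - (p 2 x)\<^sup>2) - b1' x * p 0 x * p 1 x - b1 x * (p 1 x)\<^sup>2 - b1 x * p 0 x * p 2 x)
    + (e * (q 0 x * q 4 x - (q 2 x)\<^sup>2) - b2' x * q 0 x * q 1 x - b2 x * (q 1 x)\<^sup>2 - b2 x * q 0 x * q 2 x)" for x
  have G': "(G has_real_derivative G' x) (at x)" if "x \<in> {0<..<1}" for x
    unfolding G_def G1_def G2_def G'_def using dp[OF that] dq[OF that] b1[OF that] b2[OF that]
    by (auto intro!: derivative_eq_intros simp: algebra_simps power2_eq_square)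
  have diss: "G' x \<le> k - \<kappa> * ((p 0 x)\<^sup>2 + (p 1 x)\<^sup>2 + (q 0 x)\<^sup>2 + (q 1 x)\<^sup>2)"
    if "x \<in> {0<..<1} - N" for x
  proof -
    have x: "x \<in> {0<..<1}" using that by simp
    show ?thesis
      unfolding G'_def k_def
      by (rule coupled_energy_dissipation[OF less_imp_le[OF e] \<beta> \<delta> b_ge(1)[OF x] b'_le(1)[OF that]
        b_ge(2)[OF x] b'_le(2)[OF that] d_le[OF that] c_ge(1)[OF x] c_ge(2)[OF x]
        eq1[OF that] eq2[OF that] \<kappa>(2,3)])
  qed

  have cont: "continuous_on {0<..<1} (p j)" "continuous_on {0<..<1} (q j)" if "j < 4" for j
    by (rule DERIV_continuous_on[OF has_field_derivative_at_within[OF p[OF that]]], assumption)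
       (rule DERIV_continuous_on[OF has_field_derivative_at_within[OF q[OF that]]], assumption)
  have "\<exists>K. \<forall>x\<in>{0<..<1}. \<bar>p 0 x\<bar> \<le> K" "\<exists>K. \<forall>x\<in>{0<..<1}. \<bar>p 1 x\<bar> \<le> K"
    using cont(1)[of 0] cont(1)[of 1] p_0 p_1[of 0] p_1[of 1] bounded_open_interval by auto
  then obtain K0 K1 where K_p: "\<And>x. x \<in> {0<..<1} \<Longrightarrow> \<bar>p 0 x\<bar> \<le> K0" "\<And>x. x \<in> {0<..<1} \<Longrightarrow> \<bar>p 1 x\<bar> \<le> K1"
    by blast
  have "\<exists>K. \<forall>x\<in>{0<..<1}. \<bar>q 0 x\<bar> \<le> K" "\<exists>K. \<forall>x\<in>{0<..<1}. \<bar>q 1 x\<bar> \<le> K"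
    using cont(2)[of 0] cont(2)[of 1] q_0[of 0] q_0[of 1] q_1 bounded_open_interval by auto
  then obtain K0' K1' where K_q: "\<And>x. x \<in> {0<..<1} \<Longrightarrow> \<bar>q 0 x\<bar> \<le> K0'" "\<And>x. x \<in> {0<..<1} \<Longrightarrow> \<bar>q 1 x\<bar> \<le> K1'"
    by blast

  have "\<exists>K. \<forall>x\<in>{0<..<1}. \<bar>p 2 x\<bar> \<le> K \<and> \<bar>p 3 x\<bar> \<le> K"
  proof (rule bounded_second_third_derivative[where y = p, OF N e p b1 b_le(1) b'_le(1) K_p(2)])
    show "\<bar>e * p 4 x - b1 x * p 2 x\<bar> \<le> M + C * K0" if "x \<in> {0<..<1} - N" for x
    proof -
      have "\<bar>c1 x * p 0 x\<bar> \<le> C * K0"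
        unfolding abs_mult using c_le(1)[of x] K_p(1)[of x] that by (intro mult_mono) auto
      with eq1[OF that] show ?thesis by linarith
    qed
  qed auto
  then obtain K where K: "\<And>x. x \<in> {0<..<1} \<Longrightarrow> \<bar>p 2 x\<bar> \<le> K" "\<And>x. x \<in> {0<..<1} \<Longrightarrow> \<bar>p 3 x\<bar> \<le> K"
    by blast
  have "\<exists>K. \<forall>x\<in>{0<..<1}. \<bar>q 2 x\<bar> \<le> K \<and> \<bar>q 3 x\<bar> \<le> K"
  proof (rule bounded_second_third_derivative[where y = q, OF N e q b2 b_le(2) b'_le(2) K_q(2)])
    show "\<bar>e * q 4 x - b2 x * q 2 x\<bar> \<le> M + C * K0' + D * K0" if "x \<in> {0<..<1} - N" for x
    proof -
      have "\<bar>c2 x * q 0 x\<bar> \<le> C * K0'"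
        unfolding abs_mult using c_le(2)[of x] K_q(1)[of x] that by (intro mult_mono) auto
      moreover have "\<bar>d x * p 0 x\<bar> \<le> D * K0"
        unfolding abs_mult using d_le[of x] K_p(1)[of x] that by (intro mult_mono) auto
      ultimately show ?thesis using eq2[OF that] by linarith
    qed
  qed auto
  then obtain K' where K': "\<And>x. x \<in> {0<..<1} \<Longrightarrow> \<bar>q 2 x\<bar> \<le> K'" "\<And>x. x \<in> {0<..<1} \<Longrightarrow> \<bar>q 3 x\<bar> \<le> K'"
    by blast

  have near_0: "\<forall>\<^sub>F s in at_right 0. s \<in> {0<..<1::real}"
    by (rule eventually_at_right_real) simp
  have near_1: "\<forall>\<^sub>F s in at_left 1. s \<in> {0<..<1::real}"
    by (rule eventually_at_left_real) simp
  \<comment> \<open>At the outer ends the second and third derivatives need not converge; a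
    vanishing function times a bounded one is enough.\<close>
  have null: "((\<lambda>s. f s * g s) \<longlongrightarrow> 0) F"
    if "(f \<longlongrightarrow> 0) F" "\<forall>\<^sub>F s in F. s \<in> {0<..<1::real}" "\<And>s. s \<in> {0<..<1} \<Longrightarrow> \<bar>g s\<bar> \<le> Z"
    for f g :: "real \<Rightarrow> real" and F Z
    by (rule lim_null_mult_right_bounded[OF that(1), of _ Z])
       (use that in \<open>auto elim: eventually_mono\<close>)
  \<comment> \<open>These are the cofactors of \<open>p 0\<close> and \<open>p 1\<close> when
    \<open>G1\<close> is regrouped as \<open>p 0 (e p 3 - b1 p 1) - p 1 (e p 2)\<close>.\<close>
  have bp: "\<bar>e * p 3 s - b1 s * p 1 s\<bar> \<le> e * K + B * K1" "\<bar>e * p 2 s\<bar> \<le> e * K"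
    if "s \<in> {0<..<1}" for s
  proof -
    have "\<bar>b1 s * p 1 s\<bar> \<le> B * K1"
      unfolding abs_mult using b_le(1)[OF that] K_p(2)[OF that] by (intro mult_mono) auto
    moreover have "\<bar>e * p 3 s\<bar> \<le> e * K"
      using e K(2)[OF that] by (simp add: abs_mult)
    ultimately show "\<bar>e * p 3 s - b1 s * p 1 s\<bar> \<le> e * K + B * K1" by linarith
    show "\<bar>e * p 2 s\<bar> \<le> e * K"
      using e K(1)[OF that] by (simp add: abs_mult)
  qed
  have bq: "\<bar>e * q 3 s - b2 s * q 1 s\<bar> \<le> e * K' + B * K1'" "\<bar>e * q 2 s\<bar> \<le> e * K'"
    if "s \<in> {0<..<1}" for s
  proof -
    have "\<bar>b2 s * q 1 s\<bar> \<le> B * K1'"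
      unfolding abs_mult using b_le(2)[OF that] K_q(2)[OF that] by (intro mult_mono) auto
    moreover have "\<bar>e * q 3 s\<bar> \<le> e * K'"
      using e K'(2)[OF that] by (simp add: abs_mult)
    ultimately show "\<bar>e * q 3 s - b2 s * q 1 s\<bar> \<le> e * K' + B * K1'" by linarith
    show "\<bar>e * q 2 s\<bar> \<le> e * K'"
      using e K'(1)[OF that] by (simp add: abs_mult)
  qed
  \<comment> \<open>\<open>A\<close> is the limit of \<open>G1\<close> at 1 and of \<open>G2\<close>
    at 0, while \<open>G1\<close> at 0 and \<open>G2\<close> at 1 tend to 0. So \<open>G\<close> has
    the limit \<open>A\<close> at both ends.\<close>
  define A where "A = e * (m 0 * m 3 - m 1 * m 2) - bm * m 0 * m 1"
  have G1_0: "(G1 \<longlongrightarrow> 0) (at_right 0)"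
  proof -
    have "((\<lambda>s. p 0 s * (e * p 3 s - b1 s * p 1 s) - p 1 s * (e * p 2 s)) \<longlongrightarrow> 0 - 0) (at_right 0)"
      by (intro tendsto_diff null[OF p_0(1) near_0 bp(1)] null[OF p_0(2) near_0 bp(2)])
    then show ?thesis by (simp add: G1_def[abs_def] algebra_simps)
  qed
  have G2_1: "(G2 \<longlongrightarrow> 0) (at_left 1)"
  proof -
    have "((\<lambda>s. q 0 s * (e * q 3 s - b2 s * q 1 s) - q 1 s * (e * q 2 s)) \<longlongrightarrow> 0 - 0) (at_left 1)"
      by (intro tendsto_diff null[OF q_1(1) near_1 bq(1)] null[OF q_1(2) near_1 bq(2)])
    then show ?thesis by (simp add: G2_def[abs_def] algebra_simps)
  qed
  have G1_1: "(G1 \<longlongrightarrow> A) (at_left 1)" and G2_0: "(G2 \<longlongrightarrow> A) (at_right 0)"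
    unfolding G1_def G2_def A_def by (intro tendsto_intros p_1 q_0 b_lim; simp)+
  have G_0: "(G \<longlongrightarrow> A) (at_right 0)" and G_1: "(G \<longlongrightarrow> A) (at_left 1)"
    unfolding G_def using tendsto_add[OF G1_0 G2_0] tendsto_add[OF G1_1 G2_1] by simp_all

  \<comment> \<open>The dissipation leaves room for a further function \<open>w\<close> beside
    \<open>G\<close>, as long as \<open>w'\<close> does not exceed it: the sum still grows at most
    at rate \<open>k\<close>.\<close>
  have step: "G t - G s + (w t - w s) \<le> k * (t - s)"
    if "0 < s" "s \<le> t" "t < 1" and w: "\<And>z. z \<in> {0<..<1} \<Longrightarrow> (w has_real_derivative w' z) (at z)"
      and w': "\<And>z. z \<in> {0<..<1} \<Longrightarrow> w' z \<le> \<kappa> * ((p 0 z)\<^sup>2 + (p 1 z)\<^sup>2 + (q 0 z)\<^sup>2 + (q 1 z)\<^sup>2)"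
    for s t w w'
  proof -
    have "(G t + w t) - (G s + w s) \<le> k * (t - s)"
    proof (rule increment_le_AE_derivative_bound[OF N \<open>s \<le> t\<close>])
      show "((\<lambda>z. G z + w z) has_real_derivative G' z + w' z) (at z)" if "z \<in> {s..t}" for z
        using that \<open>0 < s\<close> \<open>t < 1\<close> by (intro DERIV_add G' w) auto
      show "G' z + w' z \<le> k" if "z \<in> {s..t} - N" for z
        using diss[of z] w'[of z] that \<open>0 < s\<close> \<open>t < 1\<close> by auto
    qed
    then show ?thesis by simp
  qed
  have sq: "\<bar>2 * \<kappa> * (y0 * y1)\<bar> \<le> \<kappa> * (y0\<^sup>2 + y1\<^sup>2)" for y0 y1
  proof -
    have "\<kappa> * (2 * \<bar>y0\<bar> * \<bar>y1\<bar>) \<le> \<kappa> * (y0\<^sup>2 + y1\<^sup>2)"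
      using sum_squares_bound[of "\<bar>y0\<bar>" "\<bar>y1\<bar>"] \<kappa>(1) by (intro mult_left_mono) auto
    then show ?thesis using \<kappa>(1) by (simp add: abs_mult mult_ac)
  qed
  have nonneg: "0 \<le> \<kappa> * (y\<^sup>2 + z\<^sup>2)" for y z using \<kappa>(1) by simp
  have flat: "G t - G s \<le> k * (t - s)" if "0 < s" "s \<le> t" "t < 1" for s t
    using step[OF that, of "\<lambda>_. 0" "\<lambda>_. 0"] \<kappa>(1) by simp
  \<comment> \<open>On \<open>{s..x}\<close> the room is used for \<kappa> times the square of
    \<open>p 0\<close>, starting near the end where \<open>p 0\<close> vanishes; on
    \<open>{x..t}\<close> nothing is added.\<close>
  have p_step: "\<kappa> * (p 0 x)\<^sup>2 - \<kappa> * (p 0 s)\<^sup>2 + (G t - G s) \<le> k * (t - s)"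
    if "0 < s" "s \<le> x" "x \<le> t" "t < 1" for s t
  proof -
    have "G x - G s + (\<kappa> * (p 0 x)\<^sup>2 - \<kappa> * (p 0 s)\<^sup>2) \<le> k * (x - s)"
    proof (rule step[where w' = "\<lambda>z. 2 * \<kappa> * (p 0 z * p 1 z)"])
      show "((\<lambda>z. \<kappa> * (p 0 z)\<^sup>2) has_real_derivative 2 * \<kappa> * (p 0 z * p 1 z)) (at z)"
        if "z \<in> {0<..<1}" for z
        using dp(1)[OF that] by (auto intro!: derivative_eq_intros)
      show "2 * \<kappa> * (p 0 z * p 1 z) \<le> \<kappa> * ((p 0 z)\<^sup>2 + (p 1 z)\<^sup>2 + (q 0 z)\<^sup>2 + (q 1 z)\<^sup>2)" for z
        using sq[of "p 0 z" "p 1 z"] nonneg[of "q 0 z" "q 1 z"] unfolding distrib_left by linarith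
    qed (use that in auto)
    with flat[of x t] that show ?thesis by (simp add: algebra_simps)
  qed
  \<comment> \<open>Mirror image: \<open>q 0\<close> vanishes at the right end, so the negative of
    \<kappa> times its square is added on \<open>{x..t}\<close> and nothing on
    \<open>{s..x}\<close>.\<close>
  have q_step: "\<kappa> * (q 0 x)\<^sup>2 - \<kappa> * (q 0 t)\<^sup>2 + (G t - G s) \<le> k * (t - s)"
    if "0 < s" "s \<le> x" "x \<le> t" "t < 1" for s t
  proof -
    have "G t - G x + (- \<kappa> * (q 0 t)\<^sup>2 - (- \<kappa> * (q 0 x)\<^sup>2)) \<le> k * (t - x)"
    proof (rule step[where w' = "\<lambda>z. - (2 * \<kappa> * (q 0 z * q 1 z))"])
      show "((\<lambda>z. - \<kappa> * (q 0 z)\<^sup>2) has_real_derivative - (2 * \<kappa> * (q 0 z * q 1 z))) (at z)"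
        if "z \<in> {0<..<1}" for z
        using dq(1)[OF that] by (auto intro!: derivative_eq_intros)
      show "- (2 * \<kappa> * (q 0 z * q 1 z)) \<le> \<kappa> * ((p 0 z)\<^sup>2 + (p 1 z)\<^sup>2 + (q 0 z)\<^sup>2 + (q 1 z)\<^sup>2)" for z
        using sq[of "q 0 z" "q 1 z"] nonneg[of "p 0 z" "p 1 z"] unfolding distrib_left by linarith
    qed (use that in auto)
    with flat[of s x] that show ?thesis by (simp add: algebra_simps)
  qed
  have left: "\<forall>\<^sub>F s in at_right 0. 0 < s \<and> s \<le> x"
    using eventually_at_right_real[of 0 x] x by (auto elim: eventually_mono)
  have right: "\<forall>\<^sub>F t in at_left 1. x \<le> t \<and> t < 1"
    using eventually_at_left_real[of x 1] x by (auto elim: eventually_mono)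
  \<comment> \<open>One limit argument serves both unknowns, with \<open>f\<close> the function
    \<open>p 0\<close> and \<open>g\<close> zero, or \<open>f\<close> zero and \<open>g\<close> the
    function \<open>q 0\<close>. First \<open>s\<close> tends to 0, then \<open>t\<close> to 1; the
    two limits of \<open>G\<close> cancel and the length becomes 1.\<close>
  have limit: "\<kappa> * z\<^sup>2 \<le> k"
    if le: "\<And>s t. 0 < s \<Longrightarrow> s \<le> x \<Longrightarrow> x \<le> t \<Longrightarrow> t < 1 \<Longrightarrow>
        \<kappa> * z\<^sup>2 - \<kappa> * (f s)\<^sup>2 - \<kappa> * (g t)\<^sup>2 + (G t - G s) \<le> k * (t - s)"
      and f: "(f \<longlongrightarrow> 0) (at_right 0)" and g: "(g \<longlongrightarrow> 0) (at_left 1)" for z and f g :: "real \<Rightarrow> real"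
  proof -
    have "\<kappa> * z\<^sup>2 - \<kappa> * 0\<^sup>2 - \<kappa> * (g t)\<^sup>2 + (G t - A) \<le> k * (t - 0)" if "x \<le> t" "t < 1" for t
    proof (rule tendsto_le[of "at_right (0::real)"])
      show "((\<lambda>s. k * (t - s)) \<longlongrightarrow> k * (t - 0)) (at_right 0)"
        by (intro tendsto_intros)
      show "((\<lambda>s. \<kappa> * z\<^sup>2 - \<kappa> * (f s)\<^sup>2 - \<kappa> * (g t)\<^sup>2 + (G t - G s)) \<longlongrightarrow>
          \<kappa> * z\<^sup>2 - \<kappa> * 0\<^sup>2 - \<kappa> * (g t)\<^sup>2 + (G t - A)) (at_right 0)"
        by (intro tendsto_intros f G_0)
      show "\<forall>\<^sub>F s in at_right 0. \<kappa> * z\<^sup>2 - \<kappa> * (f s)\<^sup>2 - \<kappa> * (g t)\<^sup>2 + (G t - G s) \<le> k * (t - s)"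
        using left by (rule eventually_mono) (use le that in auto)
    qed simp
    note * = this
    have "\<kappa> * z\<^sup>2 - \<kappa> * 0\<^sup>2 - \<kappa> * 0\<^sup>2 + (A - A) \<le> k * (1 - 0)"
    proof (rule tendsto_le[of "at_left (1::real)"])
      show "((\<lambda>t. k * (t - 0)) \<longlongrightarrow> k * (1 - 0)) (at_left 1)"
        by (intro tendsto_intros)
      show "((\<lambda>t. \<kappa> * z\<^sup>2 - \<kappa> * 0\<^sup>2 - \<kappa> * (g t)\<^sup>2 + (G t - A)) \<longlongrightarrow>
          \<kappa> * z\<^sup>2 - \<kappa> * 0\<^sup>2 - \<kappa> * 0\<^sup>2 + (A - A)) (at_left 1)"
        by (intro tendsto_intros g G_1)
      show "\<forall>\<^sub>F t in at_left 1. \<kappa> * z\<^sup>2 - \<kappa> * 0\<^sup>2 - \<kappa> * (g t)\<^sup>2 + (G t - A) \<le> k * (t - 0)"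
        using right by (rule eventually_mono) (use * in auto)
    qed simp
    then show ?thesis by simp
  qed
  show ?thesis
    unfolding \<kappa>_def[symmetric] k_def[symmetric]
  proof
    show "\<kappa> * (p 0 x)\<^sup>2 \<le> k"
      by (rule limit[of _ "p 0" "\<lambda>_. 0"]) (use p_step p_0 in auto)
    show "\<kappa> * (q 0 x)\<^sup>2 \<le> k"
      by (rule limit[of _ "\<lambda>_. 0" "q 0"]) (use q_step q_1 in auto)
  qed
qed

section \<open>Essential suprema and negligible sets\<close>

text \<open>An explicit exceptional set is the form in which the estimates above take their data.
  Finiteness of the essential supremum matters, because otherwise the norm would be the default
  value 0.\<close>

lemma in_Linf_bound:
  assumes "in_Linf S g" and "S \<in> sets lebesgue"
  obtains N where "negligible N" and "\<And>x. x \<in> S - N \<Longrightarrow> \<bar>g x\<bar> \<le> Linf_norm S g"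
proof -
  define E where "E = esssup (lebesgue_on S) (\<lambda>x. ereal \<bar>g x\<bar>)"
  have "AE x in lebesgue_on S. ereal \<bar>g x\<bar> \<le> E"
    unfolding E_def by (rule esssup_AE)
  then have "AE x in lebesgue. x \<in> S \<longrightarrow> ereal \<bar>g x\<bar> \<le> E"
    using assms(2) by (simp add: AE_restrict_space_iff)
  then obtain N where N: "N \<in> null_sets lebesgue" "{x. \<not> (x \<in> S \<longrightarrow> ereal \<bar>g x\<bar> \<le> E)} \<subseteq> N"
    by (auto simp: eventually_ae_filter)
  have "\<bar>g x\<bar> \<le> Linf_norm S g" if "x \<in> S - N" for x
  proof -
    have "ereal \<bar>g x\<bar> \<le> E" using that N(2) by blast
    moreover have "E < \<infinity>" using assms(1) by (simp add: in_Linf_def E_def)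
    ultimately show ?thesis unfolding Linf_norm_def E_def[symmetric] by (cases E) auto
  qed
  with N(1) that show ?thesis by (auto simp: negligible_iff_null_sets)
qed

text \<open>The way back from a pointwise bound to the norm. \<open>K \<ge> 0\<close> covers a
  negligible \<open>S\<close>, where the essential supremum is minus infinity and the norm is
  0.\<close>

lemma in_LinfI:
  assumes g: "g \<in> borel_measurable (lebesgue_on S)" and "S \<in> sets lebesgue"
    and "negligible N" and "\<And>x. x \<in> S - N \<Longrightarrow> \<bar>g x\<bar> \<le> K" and "K \<ge> 0"
  shows "in_Linf S g" and "Linf_norm S g \<le> K"
proof -
  have "AE x in lebesgue. x \<notin> N"
    using assms(3) by (intro AE_not_in) (simp add: negligible_iff_null_sets)
  then have "AE x in lebesgue. x \<in> S \<longrightarrow> ereal \<bar>g x\<bar> \<le> ereal K"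
    by (rule eventually_mono) (use assms(4) in auto)
  then have "AE x in lebesgue_on S. ereal \<bar>g x\<bar> \<le> ereal K"
    using assms(2) by (simp add: AE_restrict_space_iff)
  with g have le: "esssup (lebesgue_on S) (\<lambda>x. ereal \<bar>g x\<bar>) \<le> ereal K"
    by (intro esssup_I) auto
  then show "in_Linf S g"
    using g unfolding in_Linf_def by (auto simp: less_top[symmetric] top_ereal_def)
  show "Linf_norm S g \<le> K"
    using le \<open>K \<ge> 0\<close> unfolding Linf_norm_def
    by (cases "esssup (lebesgue_on S) (\<lambda>x. ereal \<bar>g x\<bar>)") auto
qed

lemma Linf_norm_nonneg:
  assumes "in_Linf S g" and "S \<in> sets lebesgue" and "\<not> negligible S"
  shows "Linf_norm S g \<ge> 0"
proof -
  obtain N where N: "negligible N" "\<And>x. x \<in> S - N \<Longrightarrow> \<bar>g x\<bar> \<le> Linf_norm S g"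
    using in_Linf_bound[OF assms(1,2)] by blast
  obtain x where "x \<in> S - N"
    using assms(3) N(1) negligible_subset by blast
  from N(2)[OF this] show ?thesis by linarith
qed

section \<open>Lifting of the boundary data\<close>

text \<open>Four conditions fix a cubic. In the equation only its values and its second derivative
  survive, and these are bounded by the data.\<close>

lemma cubic_Hermite_interpolation:
  fixes \<alpha> \<beta> A B :: real
  defines "s \<equiv> \<bar>\<alpha>\<bar> + \<bar>\<beta>\<bar> + \<bar>A\<bar> + \<bar>B\<bar>"
  obtains w :: "real poly"
  where "poly w 0 = \<alpha>" "poly (pderiv w) 0 = \<beta>" "poly w 2 = A" "poly (pderiv w) 2 = B"
    and "(pderiv ^^ 4) w = 0"
    and "\<And>x. x \<in> {0..2} \<Longrightarrow> \<bar>poly w x\<bar> \<le> 20 * s"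
    and "\<And>x. x \<in> {0..2} \<Longrightarrow> \<bar>poly ((pderiv ^^ 2) w) x\<bar> \<le> 20 * s"
proof -
  \<comment> \<open>The conditions at 2 amount to the linear system \<open>4 c + 8 d = P\<close>,
    \<open>4 c + 12 d = Q\<close>.\<close>
  define P where "P = A - \<alpha> - 2 * \<beta>"
  define Q where "Q = B - \<beta>"
  define c where "c = (3 * P - 2 * Q) / 4"
  define d where "d = (Q - P) / 4"
  define w where "w = [:\<alpha>, \<beta>, c, d:]"
  \<comment> \<open>With these crude bounds the polynomial is at most \<open>19 * s\<close> and its
    second derivative at most \<open>16 * s\<close> in absolute value on \<open>{0..2}\<close>; 20
    covers both.\<close>
  have c: "\<bar>c\<bar> \<le> 2 * s" and d: "\<bar>d\<bar> \<le> s"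
    by (simp_all add: c_def d_def P_def Q_def s_def)
  show ?thesis
  proof
    show "poly w 0 = \<alpha>" "poly (pderiv w) 0 = \<beta>" "(pderiv ^^ 4) w = 0"
      by (simp_all add: w_def pderiv_pCons eval_nat_numeral)
    show "poly w 2 = A" "poly (pderiv w) 2 = B"
      by (simp_all add: w_def pderiv_pCons c_def d_def P_def Q_def field_simps)
    fix x :: real assume x: "x \<in> {0..2}"
    have pow: "\<bar>a * x ^ n\<bar> \<le> \<bar>a\<bar> * 2 ^ n" for a :: real and n
      using x unfolding abs_mult by (intro mult_left_mono) (auto simp: power_mono)
    have "poly w x = \<alpha> + \<beta> * x ^ 1 + c * x ^ 2 + d * x ^ 3"
      by (simp add: w_def algebra_simps power2_eq_square power3_eq_cube)
    moreover have "\<bar>\<alpha>\<bar> \<le> s" "\<bar>\<beta>\<bar> \<le> s" by (auto simp: s_def)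
    ultimately show "\<bar>poly w x\<bar> \<le> 20 * s"
      using pow[of \<beta> 1] pow[of c 2] pow[of d 3] c d by simp linarith
    have "poly ((pderiv ^^ 2) w) x = 2 * c + (6 * d) * x ^ 1"
      by (simp add: w_def pderiv_pCons eval_nat_numeral algebra_simps)
    then show "\<bar>poly ((pderiv ^^ 2) w) x\<bar> \<le> 20 * s"
      using pow[of "6 * d" 1] c d by simp
  qed
qed

lemma tendsto_at_left_shift:
  fixes f :: "real \<Rightarrow> 'a::topological_space"
  assumes "(f \<longlongrightarrow> l) (at_left (a + d))"
  shows "((\<lambda>x. f (x + d)) \<longlongrightarrow> l) (at_left a)"
proof (rule filterlim_compose[OF assms])
  show "filterlim (\<lambda>x. x + d) (at_left (a + d)) (at_left a)"
    by (auto simp: filterlim_at eventually_at_filter intro!: tendsto_eq_intros)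
qed

lemma tendsto_poly_at_left_right:
  fixes P :: "real poly"
  shows "(poly P \<longlongrightarrow> poly P a) (at_left a)" and "(poly P \<longlongrightarrow> poly P a) (at_right a)"
  using poly_isCont[of a P] unfolding isCont_def by (auto intro: tendsto_mono[OF at_le])

section \<open>The pointwise bound for fixed \<epsilon>\<close>

text \<open>Subtracting the lifts reduces the system to the energy estimate. \<open>C\<close> is
  built from \<open>B\<close>, \<delta> and \<beta> alone, which gives uniformity in \<epsilon>.
  \<open>B\<close> bounds \<open>d\<close> on the whole interval, because the history is multiplied
  by \<open>d\<close> on (0,1), where \<open>D\<close> gives no control.\<close>

lemma shift_system_bound:
  fixes b b' c d f \<Phi> u\<^sub>1 u\<^sub>2 :: "real \<Rightarrow> real" and \<beta> \<delta> :: real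
  assumes \<epsilon>: "\<epsilon> > 0" and \<beta>: "\<beta>\<^sup>2 > 0" and \<delta>: "\<delta> > 0"
    and b': "\<And>x. x \<in> {0<..<2} \<Longrightarrow> (b has_real_derivative b' x) (at x)"
    and B: "\<And>x. x \<in> {0..2} \<Longrightarrow> \<bar>b x\<bar> \<le> B" "\<And>x. x \<in> {0..2} \<Longrightarrow> \<bar>c x\<bar> \<le> B"
      "\<And>x. x \<in> {0..2} \<Longrightarrow> \<bar>d x\<bar> \<le> B"
    and b_ge: "\<And>x. x \<in> {0..2} \<Longrightarrow> b x \<ge> \<beta>\<^sup>2"
    and c_ge: "\<And>x. x \<in> {0..2} \<Longrightarrow> c x - 1/2 * D - 1 / (2 * \<beta>\<^sup>2) * L\<^sup>2 \<ge> \<delta>"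
    and N: "negligible N\<^sub>b" "negligible N\<^sub>d" "negligible N\<^sub>f" "negligible N\<^sub>\<Phi>"
    and L: "\<And>x. x \<in> {0<..<2} - N\<^sub>b \<Longrightarrow> \<bar>b' x\<bar> \<le> L"
    and D: "\<And>x. x \<in> {1<..<2} - N\<^sub>d \<Longrightarrow> \<bar>d x\<bar> \<le> D"
    and F: "\<And>x. x \<in> {0<..<2} - N\<^sub>f \<Longrightarrow> \<bar>f x\<bar> \<le> F" "F \<ge> 0"
    and H: "\<And>x. x \<in> {-1<..<0} - N\<^sub>\<Phi> \<Longrightarrow> \<bar>\<Phi> x\<bar> \<le> H" "H \<ge> 0"
    and sol: "solves_shift_system \<epsilon> b c d f \<Phi> u\<^sub>1 u\<^sub>2"
    and bc: "boundary_conditions \<alpha>\<^sub>1 \<alpha>\<^sub>2 \<alpha>\<^sub>3 \<beta>\<^sub>1 \<beta>\<^sub>2 \<beta>\<^sub>3 \<delta>\<^sub>1 \<delta>\<^sub>2 u\<^sub>1 u\<^sub>2"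
    and mc: "matching_conditions u\<^sub>1 u\<^sub>2"
  defines "T \<equiv> F + \<bar>\<alpha>\<^sub>1\<bar> + \<bar>\<alpha>\<^sub>3\<bar> + \<bar>\<delta>\<^sub>1\<bar> + \<bar>\<delta>\<^sub>2\<bar> + \<bar>\<beta>\<^sub>1\<bar> + \<bar>\<beta>\<^sub>3\<bar> + H"
    and "C \<equiv> (1 + 123 * B) / sqrt (\<delta> * min (\<delta> / 2) (\<beta>\<^sup>2 / 2)) + 41"
  assumes x: "x \<in> {0<..<1}"
  shows "\<bar>u\<^sub>1 x\<bar> \<le> C * T" and "\<bar>u\<^sub>2 (x + 1)\<bar> \<le> C * T"
proof -
  define S where "S = \<bar>\<alpha>\<^sub>1\<bar> + \<bar>\<alpha>\<^sub>3\<bar> + \<bar>\<delta>\<^sub>1\<bar> + \<bar>\<delta>\<^sub>2\<bar> + \<bar>\<beta>\<^sub>1\<bar> + \<bar>\<beta>\<^sub>3\<bar>"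
  have S: "S \<ge> 0" by (simp add: S_def)
  have T: "T = F + S + H" by (simp add: T_def S_def)
  have B0: "B \<ge> 0" using B(1)[of 0] by simp
  obtain w where w: "poly w 0 = \<alpha>\<^sub>1" "poly (pderiv w) 0 = \<beta>\<^sub>1"
      "poly w 2 = \<alpha>\<^sub>3 - \<delta>\<^sub>1 - \<delta>\<^sub>2" "poly (pderiv w) 2 = \<beta>\<^sub>3 - \<delta>\<^sub>2" "(pderiv ^^ 4) w = 0"
    and w_le: "\<And>x. x \<in> {0..2} \<Longrightarrow>
        \<bar>poly w x\<bar> \<le> 20 * (\<bar>\<alpha>\<^sub>1\<bar> + \<bar>\<beta>\<^sub>1\<bar> + \<bar>\<alpha>\<^sub>3 - \<delta>\<^sub>1 - \<delta>\<^sub>2\<bar> + \<bar>\<beta>\<^sub>3 - \<delta>\<^sub>2\<bar>)"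
      "\<And>x. x \<in> {0..2} \<Longrightarrow>
        \<bar>poly ((pderiv ^^ 2) w) x\<bar> \<le> 20 * (\<bar>\<alpha>\<^sub>1\<bar> + \<bar>\<beta>\<^sub>1\<bar> + \<bar>\<alpha>\<^sub>3 - \<delta>\<^sub>1 - \<delta>\<^sub>2\<bar> + \<bar>\<beta>\<^sub>3 - \<delta>\<^sub>2\<bar>)"
    using cubic_Hermite_interpolation by blast
  \<comment> \<open>The added polynomial is
    \<open>\<delta>\<^sub>1 + \<delta>\<^sub>2 (x - 1)\<close>: at 1 it produces exactly the
    prescribed jumps of value and slope. The data of \<open>w\<close> at 2 are corrected so that
    \<open>v\<close> takes the values \<open>\<alpha>\<^sub>3\<close> and
    \<open>\<beta>\<^sub>3\<close> there.\<close>
  define v where "v = w + [:\<delta>\<^sub>1 - \<delta>\<^sub>2, \<delta>\<^sub>2:]"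
  have v_w: "pderiv v = pderiv w + [:\<delta>\<^sub>2:]" "(pderiv ^^ 2) v = (pderiv ^^ 2) w"
    "(pderiv ^^ 3) v = (pderiv ^^ 3) w" "(pderiv ^^ 4) v = 0"
    using w(5) by (simp_all add: v_def pderiv_add pderiv_pCons eval_nat_numeral)
  \<comment> \<open>\<open>\<delta>\<^sub>2\<close> occurs in both data at 2, which doubles the
    factor 20.\<close>
  have "20 * (\<bar>\<alpha>\<^sub>1\<bar> + \<bar>\<beta>\<^sub>1\<bar> + \<bar>\<alpha>\<^sub>3 - \<delta>\<^sub>1 - \<delta>\<^sub>2\<bar> + \<bar>\<beta>\<^sub>3 - \<delta>\<^sub>2\<bar>) \<le> 40 * S"
    unfolding S_def by (smt (verit))
  with w_le have w_le: "\<bar>poly w x\<bar> \<le> 40 * S" "\<bar>poly ((pderiv ^^ 2) w) x\<bar> \<le> 40 * S"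
    if "x \<in> {0..2}" for x
    using that by (meson order_trans)+
  have v_le: "\<bar>poly v (x + 1)\<bar> \<le> 41 * S" if "x \<in> {0..1}" for x
  proof -
    have "\<bar>\<delta>\<^sub>2 * x\<bar> \<le> \<bar>\<delta>\<^sub>2\<bar>"
      using that by (simp add: abs_mult mult_left_le)
    then have "\<bar>\<delta>\<^sub>1 + \<delta>\<^sub>2 * x\<bar> \<le> S" unfolding S_def by linarith
    moreover have "poly v (x + 1) = poly w (x + 1) + (\<delta>\<^sub>1 + \<delta>\<^sub>2 * x)"
      by (simp add: v_def algebra_simps)
    ultimately show ?thesis using w_le(1)[of "x + 1"] that by simp
  qed
  define p where "p k x = nderiv k u\<^sub>1 x - poly ((pderiv ^^ k) w) x" for k x
  define q where "q k x = nderiv k u\<^sub>2 (x + 1) - poly ((pderiv ^^ k) v) (x + 1)" for k x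
  \<comment> \<open>The first equation is read at \<open>x\<close> with the history at
    \<open>x - 1\<close>, the second at \<open>x + 1\<close>; the exceptional sets are translated
    accordingly.\<close>
  define N where "N = N\<^sub>f \<union> N\<^sub>b \<union> (+) 1 ` N\<^sub>\<Phi> \<union> (+) (-1) ` (N\<^sub>f \<union> N\<^sub>b \<union> N\<^sub>d)"
  \<comment> \<open>The lifts contribute at most \<open>80 * B * S\<close> to the first residual and
    \<open>121 * B * S\<close> to the second; 123 covers both.\<close>
  define M where "M = F + B * H + 123 * B * S"
  have "M \<le> (1 + 123 * B) * T"
    unfolding M_def T using F(2) H(2) B0 S
    by (simp add: algebra_simps add_increasing)
  have negN: "negligible N"
    unfolding N_def by (intro negligible_Un negligible_translation N)
  have N_shift: "x \<notin> N\<^sub>f" "x \<notin> N\<^sub>b" "x - 1 \<notin> N\<^sub>\<Phi>" "x + 1 \<notin> N\<^sub>f" "x + 1 \<notin> N\<^sub>b" "x + 1 \<notin> N\<^sub>d"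
    if "x \<notin> N" for x
  proof -
    have "x = 1 + (x - 1)" "x = -1 + (x + 1)" by simp_all
    with that show "x \<notin> N\<^sub>f" "x \<notin> N\<^sub>b" "x - 1 \<notin> N\<^sub>\<Phi>" "x + 1 \<notin> N\<^sub>f" "x + 1 \<notin> N\<^sub>b" "x + 1 \<notin> N\<^sub>d"
      unfolding N_def by blast+
  qed
  have Bmul: "\<bar>y * z\<bar> \<le> B * Z" if "\<bar>y\<bar> \<le> B" "\<bar>z\<bar> \<le> Z" for y z Z
    unfolding abs_mult using that B0 by (intro mult_mono) auto
  have BS: "B * (40 * S) = 40 * (B * S)" "B * (41 * S) = 41 * (B * S)" "0 \<le> B * H" "0 \<le> B * S"
    using B0 H(2) S by auto

  obtain m2 m3 where m: "(nderiv 2 u\<^sub>1 \<longlongrightarrow> m2) (at_left 1)" "(nderiv 2 u\<^sub>2 \<longlongrightarrow> m2) (at_right 1)"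
      "(nderiv 3 u\<^sub>1 \<longlongrightarrow> m3) (at_left 1)" "(nderiv 3 u\<^sub>2 \<longlongrightarrow> m3) (at_right 1)"
    using mc unfolding matching_conditions_def by auto
  \<comment> \<open>Although defined from \<open>u\<^sub>1\<close> and \<open>w\<close>, these are
    also the limits of \<open>q\<close> at 0: the jumps of \<open>u\<^sub>2\<close> against
    \<open>u\<^sub>1\<close> equal those of \<open>v\<close> against \<open>w\<close>.\<close>
  define m where "m k = (if k = 0 then \<alpha>\<^sub>2 else if k = 1 then \<beta>\<^sub>2 else if k = 2 then m2 else m3)
    - poly ((pderiv ^^ k) w) 1" for k
  have cases4: "k = 0 \<or> k = 1 \<or> k = 2 \<or> k = 3" if "k < 4" for k :: nat
    using that by linarith

  have bnd: "min (\<delta> / 2) (\<beta>\<^sup>2 / 2) * (p 0 x)\<^sup>2 \<le> M\<^sup>2 / \<delta> \<and>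
    min (\<delta> / 2) (\<beta>\<^sup>2 / 2) * (q 0 x)\<^sup>2 \<le> M\<^sup>2 / \<delta>"
  proof (rule energy_estimate[where p = p and q = q and m = m and bm = "b 1"
      and e = "\<epsilon>\<^sup>2" and N = N and C = B and B = B and L = L and D = D
      and ?b1.0 = b and ?b1'.0 = b' and ?b2.0 = "\<lambda>t. b (t + 1)" and ?b2'.0 = "\<lambda>t. b' (t + 1)"
      and ?c1.0 = c and ?c2.0 = "\<lambda>t. c (t + 1)" and d = "\<lambda>t. d (t + 1)"])
    show "(p k has_real_derivative p (Suc k) x) (at x)" if "k < 4" "x \<in> {0<..<1}" for k x
    proof -
      have "nderiv k u\<^sub>1 differentiable (at x)"
        using sol that unfolding solves_shift_system_def four_times_differentiable_on_def by blast
      then have "(nderiv k u\<^sub>1 has_real_derivative nderiv (Suc k) u\<^sub>1 x) (at x)"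
        by (simp add: DERIV_deriv_iff_real_differentiable)
      then show ?thesis unfolding p_def by (auto intro!: derivative_eq_intros)
    qed
    show "(q k has_real_derivative q (Suc k) x) (at x)" if "k < 4" "x \<in> {0<..<1}" for k x
    proof -
      have "nderiv k u\<^sub>2 differentiable (at (x + 1))"
        using sol that unfolding solves_shift_system_def four_times_differentiable_on_def by auto
      then have "(nderiv k u\<^sub>2 has_real_derivative nderiv (Suc k) u\<^sub>2 (x + 1)) (at (x + 1))"
        by (simp add: DERIV_deriv_iff_real_differentiable)
      then have "((\<lambda>x. nderiv k u\<^sub>2 x - poly ((pderiv ^^ k) v) x) has_real_derivative
          nderiv (Suc k) u\<^sub>2 (x + 1) - poly ((pderiv ^^ Suc k) v) (x + 1)) (at (x + 1))"
        by (auto intro!: derivative_eq_intros)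
      then show ?thesis unfolding q_def DERIV_shift .
    qed
    show "(b has_real_derivative b' x) (at x)"
      "((\<lambda>t. b (t + 1)) has_real_derivative b' (x + 1)) (at x)"
      "b x \<ge> \<beta>\<^sup>2" "b (x + 1) \<ge> \<beta>\<^sup>2" "\<bar>b x\<bar> \<le> B" "\<bar>b (x + 1)\<bar> \<le> B" "\<bar>c x\<bar> \<le> B" "\<bar>c (x + 1)\<bar> \<le> B"
      "c x - 1/2 * D - 1 / (2 * \<beta>\<^sup>2) * L\<^sup>2 \<ge> \<delta>" "c (x + 1) - 1/2 * D - 1 / (2 * \<beta>\<^sup>2) * L\<^sup>2 \<ge> \<delta>"
      if "x \<in> {0<..<1}" for x
      using that b'[of x] b'[of "x + 1"] b_ge[of x] b_ge[of "x + 1"] B(1,2)[of x] B(1,2)[of "x + 1"]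
        c_ge[of x] c_ge[of "x + 1"]
      by (simp_all add: DERIV_shift)
    show "\<bar>b' x\<bar> \<le> L" "\<bar>b' (x + 1)\<bar> \<le> L" "\<bar>d (x + 1)\<bar> \<le> D" if "x \<in> {0<..<1} - N" for x
      using that N_shift[of x] by (auto intro!: L D)
    show "\<bar>\<epsilon>\<^sup>2 * p 4 x - b x * p 2 x + c x * p 0 x\<bar> \<le> M" if "x \<in> {0<..<1} - N" for x
    proof -
      have "\<epsilon>\<^sup>2 * nderiv 4 u\<^sub>1 x - b x * nderiv 2 u\<^sub>1 x + c x * u\<^sub>1 x = f x - d x * \<Phi> (x - 1)"
        using sol that unfolding solves_shift_system_def by blast
      then have "\<epsilon>\<^sup>2 * p 4 x - b x * p 2 x + c x * p 0 x
        = f x - d x * \<Phi> (x - 1) + b x * poly ((pderiv ^^ 2) w) x - c x * poly w x"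
        by (simp add: p_def w(5) algebra_simps)
      moreover have "\<bar>f x\<bar> \<le> F" "\<bar>\<Phi> (x - 1)\<bar> \<le> H"
        using that N_shift[of x] by (auto intro!: F H)
      moreover have "\<bar>d x * \<Phi> (x - 1)\<bar> \<le> B * H" "\<bar>b x * poly ((pderiv ^^ 2) w) x\<bar> \<le> B * (40 * S)"
        "\<bar>c x * poly w x\<bar> \<le> B * (40 * S)"
        using that \<open>\<bar>\<Phi> (x - 1)\<bar> \<le> H\<close> by (auto intro!: Bmul B w_le)
      ultimately show ?thesis unfolding M_def using BS by linarith
    qed
    show "\<bar>\<epsilon>\<^sup>2 * q 4 x - b (x + 1) * q 2 x + c (x + 1) * q 0 x + d (x + 1) * p 0 x\<bar> \<le> M"
      if "x \<in> {0<..<1} - N" for x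
    proof -
      have "x + 1 \<in> {1<..<2}" using that by simp
      then have "\<epsilon>\<^sup>2 * nderiv 4 u\<^sub>2 (x + 1) - b (x + 1) * nderiv 2 u\<^sub>2 (x + 1) + c (x + 1) * u\<^sub>2 (x + 1)
          = f (x + 1) - d (x + 1) * u\<^sub>1 ((x + 1) - 1)"
        using sol unfolding solves_shift_system_def by blast
      \<comment> \<open>The delayed value of \<open>u\<^sub>1\<close> splits into
        \<open>p 0 x\<close>, kept as the coupling, and the lift, moved into the residual.\<close>
      then have "\<epsilon>\<^sup>2 * q 4 x - b (x + 1) * q 2 x + c (x + 1) * q 0 x + d (x + 1) * p 0 x
        = f (x + 1) + b (x + 1) * poly ((pderiv ^^ 2) w) (x + 1) - c (x + 1) * poly v (x + 1)
          - d (x + 1) * poly w x"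
        by (simp add: p_def q_def v_w algebra_simps)
      moreover have "\<bar>f (x + 1)\<bar> \<le> F"
        using that N_shift[of x] by (auto intro!: F)
      moreover have "\<bar>d (x + 1) * poly w x\<bar> \<le> B * (40 * S)"
        "\<bar>b (x + 1) * poly ((pderiv ^^ 2) w) (x + 1)\<bar> \<le> B * (40 * S)"
        "\<bar>c (x + 1) * poly v (x + 1)\<bar> \<le> B * (41 * S)"
        using that by (auto intro!: Bmul B w_le v_le)
      ultimately show ?thesis unfolding M_def using BS by linarith
    qed
    have "((\<lambda>x. nderiv 0 u\<^sub>1 x - poly ((pderiv ^^ 0) w) x) \<longlongrightarrow> \<alpha>\<^sub>1 - poly w 0) (at_right 0)"
      "((\<lambda>x. nderiv 1 u\<^sub>1 x - poly ((pderiv ^^ 1) w) x) \<longlongrightarrow> \<beta>\<^sub>1 - poly (pderiv w) 0) (at_right 0)"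
      using bc unfolding boundary_conditions_def
      by (auto intro!: tendsto_diff tendsto_poly_at_left_right simp del: poly_isCont)
    then show "(p 0 \<longlongrightarrow> 0) (at_right 0)" "(p 1 \<longlongrightarrow> 0) (at_right 0)"
      using w unfolding p_def by simp_all
    have "((\<lambda>x. nderiv 0 u\<^sub>2 x - poly ((pderiv ^^ 0) v) x) \<longlongrightarrow> \<alpha>\<^sub>3 - poly v 2) (at_left (1 + 1))"
      "((\<lambda>x. nderiv 1 u\<^sub>2 x - poly ((pderiv ^^ 1) v) x) \<longlongrightarrow> \<beta>\<^sub>3 - poly (pderiv v) 2) (at_left (1 + 1))"
      using bc unfolding boundary_conditions_def
      by (auto intro!: tendsto_diff tendsto_poly_at_left_right)
    from this[THEN tendsto_at_left_shift]
    show "(q 0 \<longlongrightarrow> 0) (at_left 1)" "(q 1 \<longlongrightarrow> 0) (at_left 1)"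
      using w unfolding q_def v_w by (simp_all add: v_def)
    show "(p k \<longlongrightarrow> m k) (at_left 1)" if "k < 4" for k
    proof -
      have "(nderiv k u\<^sub>1 \<longlongrightarrow> m k + poly ((pderiv ^^ k) w) 1) (at_left 1)"
        using cases4[OF that] bc m unfolding boundary_conditions_def by (auto simp: m_def)
      from tendsto_diff[OF this tendsto_poly_at_left_right(1)[of "(pderiv ^^ k) w"]]
      show ?thesis unfolding p_def by simp
    qed
    show "(q k \<longlongrightarrow> m k) (at_right 0)" if "k < 4" for k
    proof -
      have "(nderiv k u\<^sub>2 \<longlongrightarrow> m k + poly ((pderiv ^^ k) v) 1) (at_right 1)"
        using cases4[OF that] bc m v_w unfolding boundary_conditions_def
        by (auto simp: m_def v_def add.assoc)
      from tendsto_diff[OF this tendsto_poly_at_left_right(2)[of "(pderiv ^^ k) v"]]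
      show ?thesis unfolding q_def filterlim_at_right_to_0[of _ _ 1] by simp
    qed
    \<comment> \<open>The point 1 is interior to (0,2), so the coefficients on the two sides share
      the limit \<open>b 1\<close>, as the cancellation at the interface requires.\<close>
    have "isCont b 1" by (rule DERIV_isCont[OF b']) simp
    then have "(b \<longlongrightarrow> b 1) (at_left 1)" "(b \<longlongrightarrow> b 1) (at_right 1)"
      by (simp_all add: continuous_within filterlim_at_split)
    then show "(b \<longlongrightarrow> b 1) (at_left 1)" "((\<lambda>t. b (t + 1)) \<longlongrightarrow> b 1) (at_right 0)"
      by (simp_all add: filterlim_at_right_to_0[of _ _ 1])
  qed (use negN \<epsilon> \<beta> \<delta> x in auto)

  define \<kappa> where "\<kappa> = min (\<delta> / 2) (\<beta>\<^sup>2 / 2)"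
  have \<kappa>: "\<kappa> > 0" using \<beta> \<delta> by (simp add: \<kappa>_def)
  have M0: "M \<ge> 0" unfolding M_def using F(2) BS by linarith
  \<comment> \<open>A square root of the energy bound yields the first summand of \<open>C\<close>;
    the lifts, bounded by \<open>41 * S\<close>, yield the second.\<close>
  have root: "\<bar>y\<bar> \<le> (1 + 123 * B) / sqrt (\<delta> * \<kappa>) * T" if "\<kappa> * y\<^sup>2 \<le> M\<^sup>2 / \<delta>" for y
  proof -
    have "y\<^sup>2 \<le> M\<^sup>2 / (\<delta> * \<kappa>)" using that \<kappa> \<delta> by (simp add: field_simps)
    then have "\<bar>y\<bar> \<le> sqrt (M\<^sup>2 / (\<delta> * \<kappa>))"
      by (metis real_sqrt_abs real_sqrt_le_mono)
    also have "\<dots> = M / sqrt (\<delta> * \<kappa>)" using M0 by (simp add: real_sqrt_divide)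
    also have "\<dots> \<le> (1 + 123 * B) * T / sqrt (\<delta> * \<kappa>)"
      using \<open>M \<le> _\<close> \<delta> \<kappa> by (intro divide_right_mono) auto
    finally show ?thesis by simp
  qed
  have "41 * S \<le> 41 * T" using T F(2) H(2) by simp
  moreover have "\<bar>p 0 x\<bar> \<le> (1 + 123 * B) / sqrt (\<delta> * \<kappa>) * T"
    "\<bar>q 0 x\<bar> \<le> (1 + 123 * B) / sqrt (\<delta> * \<kappa>) * T"
    using bnd unfolding \<kappa>_def[symmetric] by (blast intro: root)+
  moreover have "\<bar>poly w x\<bar> \<le> 41 * S" "\<bar>poly v (x + 1)\<bar> \<le> 41 * S"
    using x w_le(1)[of x] v_le[of x] S by auto
  moreover have "u\<^sub>1 x = p 0 x + poly w x" "u\<^sub>2 (x + 1) = q 0 x + poly v (x + 1)"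
    by (simp_all add: p_def q_def)
  moreover have "C * T = (1 + 123 * B) / sqrt (\<delta> * \<kappa>) * T + 41 * T"
    by (simp add: C_def \<kappa>_def algebra_simps)
  ultimately show "\<bar>u\<^sub>1 x\<bar> \<le> C * T" "\<bar>u\<^sub>2 (x + 1)\<bar> \<le> C * T"
    by linarith+
qed

section \<open>Regularity of the coefficients and measurability of the glued function\<close>

lemma smooth_on_imp_continuous_on:
  assumes "smooth_on S g"
  shows "continuous_on S g"
proof -
  obtain E where E: "\<And>x. x \<in> S \<Longrightarrow> E 0 x = g x"
    and E': "\<And>k x. x \<in> S \<Longrightarrow> (E k has_real_derivative E (Suc k) x) (at x within S)"
    using assms unfolding smooth_on_def by blast
  have "continuous_on S (E 0)"
    using E'[of _ 0] by (rule DERIV_continuous_on)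
  then show ?thesis by (rule continuous_on_eq) (rule E)
qed

text \<open>At interior points the derivative within the closed interval is the ordinary one; its
  continuity up to the ends makes it bounded.\<close>

lemma smooth_on_deriv:
  fixes g :: "real \<Rightarrow> real"
  assumes "smooth_on {l..r} g"
  obtains g' where "continuous_on {l..r} g'"
    and "\<And>x. x \<in> {l<..<r} \<Longrightarrow> (g has_real_derivative g' x) (at x)"
proof -
  obtain E where E: "\<And>x. x \<in> {l..r} \<Longrightarrow> E 0 x = g x"
    and E': "\<And>k x. x \<in> {l..r} \<Longrightarrow> (E k has_real_derivative E (Suc k) x) (at x within {l..r})"
    using assms unfolding smooth_on_def by blast
  show ?thesis
  proof
    show "continuous_on {l..r} (E (Suc 0))"
      using E'[of _ "Suc 0"] by (rule DERIV_continuous_on)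
    fix x assume x: "x \<in> {l<..<r}"
    have "(E (0::nat) has_real_derivative E (Suc 0) x) (at x)"
      using E'[of x 0] x by (simp add: at_within_Icc_at)
    then show "(g has_real_derivative E (Suc 0) x) (at x)"
      by (rule has_field_derivative_transform_within_open[OF _ open_greaterThanLessThan x])
         (use E in auto)
  qed
qed

lemma continuous_on_Icc_bounded:
  fixes g :: "real \<Rightarrow> real"
  assumes "continuous_on {l..r} g"
  shows "\<exists>K. \<forall>x\<in>{l..r}. \<bar>g x\<bar> \<le> K"
proof -
  have "bounded (g ` {l..r})"
    by (intro compact_imp_bounded compact_continuous_image assms) auto
  then show ?thesis
    unfolding bounded_iff by (metis image_eqI real_norm_def)
qed

lemma in_Linf_continuous:
  fixes g :: "real \<Rightarrow> real"
  assumes "continuous_on {l..r} g" and "l \<le> l'" and "r' \<le> r"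
  shows "in_Linf {l'<..<r'} g"
proof -
  obtain K where K: "\<And>x. x \<in> {l..r} \<Longrightarrow> \<bar>g x\<bar> \<le> K"
    using continuous_on_Icc_bounded[OF assms(1)] by blast
  have "continuous_on {l'<..<r'} g"
    by (rule continuous_on_subset[OF assms(1)]) (use assms in auto)
  then have "g \<in> borel_measurable (lebesgue_on {l'<..<r'})"
    by (intro continuous_imp_measurable_on_sets_lebesgue) auto
  moreover have "\<bar>g x\<bar> \<le> \<bar>K\<bar>" if "x \<in> {l'<..<r'} - {}" for x
    using K[of x] that assms(2,3) by auto
  ultimately show ?thesis
    by (intro in_LinfI(1)[OF _ _ negligible_empty, where K = "\<bar>K\<bar>"]) auto
qed

text \<open>At 1 the glued function takes the value \<open>u\<^sub>2 1\<close>, about which nothing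
  is assumed, so this point is treated as a separate piece.\<close>

lemma glue_measurable:
  assumes "continuous_on {0<..<1} u\<^sub>1" and "continuous_on {1<..<2} u\<^sub>2"
  shows "glue u\<^sub>1 u\<^sub>2 \<in> borel_measurable (lebesgue_on {0<..<2})"
proof -
  have "(\<lambda>x. if x \<in> S then u x else 0) \<in> borel_measurable lebesgue"
    if "continuous_on S u" "S \<in> sets lebesgue" for S and u :: "real \<Rightarrow> real"
    using that continuous_imp_measurable_on_sets_lebesgue borel_measurable_if by blast
  from this[OF assms(1)] this[OF assms(2)] this[OF continuous_on_sing[of 1 u\<^sub>2]]
  have "(\<lambda>x. (if x \<in> {0<..<1} then u\<^sub>1 x else 0) + (if x \<in> {1<..<2} then u\<^sub>2 x else 0)
      + (if x \<in> {1} then u\<^sub>2 x else 0)) \<in> borel_measurable (lebesgue_on {0<..<2})"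
    by (intro measurable_restrict_space1 borel_measurable_add) simp_all
  then show ?thesis
    by (rule measurable_cong[THEN iffD1, rotated]) (auto simp: glue_def indicator_def)
qed

section \<open>The uniform bound\<close>

text \<open>\<open>C\<close> is chosen before \<epsilon>, the data and the solution, which is what
  the generic constant means. The interface values \<open>\<alpha>\<^sub>2\<close> and
  \<open>\<beta>\<^sub>2\<close> are absent from the bound because they enter the energy only
  through the limit that cancels.\<close>

theorem lemma2p1:
  fixes b c d :: "real \<Rightarrow> real" and \<beta> \<delta> :: real
  assumes "smooth_on {0..2} b" and "smooth_on {0..2} c" and "smooth_on {0..2} d"
    and "\<forall>x\<in>{0..2}. b x \<ge> \<beta>\<^sup>2" and "\<beta>\<^sup>2 > 0"
    and "\<forall>x\<in>{0..2}. c x - 1/2 * Linf_norm {1<..<2} d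
                     - 1 / (2 * \<beta>\<^sup>2) * (Linf_norm {0<..<2} (deriv b))\<^sup>2 \<ge> \<delta>"
    and "\<delta> > 0"
  shows "\<exists>C>0. \<forall>\<epsilon>>0. \<forall>f \<Phi> \<alpha>\<^sub>1 \<alpha>\<^sub>2 \<alpha>\<^sub>3 \<beta>\<^sub>1 \<beta>\<^sub>2 \<beta>\<^sub>3 \<delta>\<^sub>1 \<delta>\<^sub>2 u\<^sub>1 u\<^sub>2.
           in_Linf {0<..<2} f \<longrightarrow> admissible_history \<Phi> \<longrightarrow>
           solves_shift_system \<epsilon> b c d f \<Phi> u\<^sub>1 u\<^sub>2 \<longrightarrow>
           boundary_conditions \<alpha>\<^sub>1 \<alpha>\<^sub>2 \<alpha>\<^sub>3 \<beta>\<^sub>1 \<beta>\<^sub>2 \<beta>\<^sub>3 \<delta>\<^sub>1 \<delta>\<^sub>2 u\<^sub>1 u\<^sub>2 \<longrightarrow>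
           matching_conditions u\<^sub>1 u\<^sub>2 \<longrightarrow>
           in_Linf {0<..<2} (glue u\<^sub>1 u\<^sub>2) \<and>
           Linf_norm {0<..<2} (glue u\<^sub>1 u\<^sub>2)
             \<le> C * (Linf_norm {0<..<2} f + \<bar>\<alpha>\<^sub>1\<bar> + \<bar>\<alpha>\<^sub>3\<bar> + \<bar>\<delta>\<^sub>1\<bar> + \<bar>\<delta>\<^sub>2\<bar> + \<bar>\<beta>\<^sub>1\<bar> + \<bar>\<beta>\<^sub>3\<bar>
                    + Linf_norm {-1<..<0} \<Phi>)"
proof -
  obtain b' where b': "continuous_on {0..2} b'"
    "\<And>x. x \<in> {0<..<2} \<Longrightarrow> (b has_real_derivative b' x) (at x)"
    using smooth_on_deriv[OF assms(1)] by blast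
  have cont: "continuous_on {0..2} b" "continuous_on {0..2} c" "continuous_on {0..2} d"
    using assms(1-3) by (auto intro: smooth_on_imp_continuous_on)
  obtain B\<^sub>1 B\<^sub>2 B\<^sub>3 where "\<forall>x\<in>{0..2}. \<bar>b x\<bar> \<le> B\<^sub>1" "\<forall>x\<in>{0..2}. \<bar>c x\<bar> \<le> B\<^sub>2" "\<forall>x\<in>{0..2}. \<bar>d x\<bar> \<le> B\<^sub>3"
    using cont[THEN continuous_on_Icc_bounded] by blast
  moreover define B where "B = max B\<^sub>1 (max B\<^sub>2 B\<^sub>3)"
  ultimately have B: "\<And>x. x \<in> {0..2} \<Longrightarrow> \<bar>b x\<bar> \<le> B" "\<And>x. x \<in> {0..2} \<Longrightarrow> \<bar>c x\<bar> \<le> B"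
    "\<And>x. x \<in> {0..2} \<Longrightarrow> \<bar>d x\<bar> \<le> B"
    by (auto simp: le_max_iff_disj)
  have B0: "B \<ge> 0" using B(1)[of 0] by simp
  have deriv_b: "deriv b x = b' x" if "x \<in> {0<..<2}" for x
    using b'(2)[OF that] by (rule DERIV_imp_deriv)
  have "in_Linf {0<..<2} b'" using b'(1) by (rule in_Linf_continuous) auto
  \<comment> \<open>\<open>deriv b\<close> at 0 and 2 depends on values of \<open>b\<close> outside
    the closed interval, so the norm is transferred from \<open>b'\<close>, which agrees with it on
    the open interval.\<close>
  moreover have "Linf_norm {0<..<2} (deriv b) = Linf_norm {0<..<2} b'"
  proof -
    have "deriv b \<in> borel_measurable (lebesgue_on {0<..<2})"
      using \<open>in_Linf {0<..<2} b'\<close> unfolding in_Linf_def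
      by (metis (no_types, lifting) deriv_b measurable_cong space_lebesgue_on)
    then show ?thesis
      using \<open>in_Linf {0<..<2} b'\<close> deriv_b unfolding Linf_norm_def in_Linf_def
      by (intro arg_cong[of _ _ real_of_ereal] esssup_AE_cong) auto
  qed
  ultimately obtain N\<^sub>b where N\<^sub>b: "negligible N\<^sub>b"
    "\<And>x. x \<in> {0<..<2} - N\<^sub>b \<Longrightarrow> \<bar>b' x\<bar> \<le> Linf_norm {0<..<2} (deriv b)"
    using in_Linf_bound[of "{0<..<2}" b'] by auto
  have "in_Linf {1<..<2} d" using cont(3) by (rule in_Linf_continuous) auto
  then obtain N\<^sub>d where N\<^sub>d: "negligible N\<^sub>d"
    "\<And>x. x \<in> {1<..<2} - N\<^sub>d \<Longrightarrow> \<bar>d x\<bar> \<le> Linf_norm {1<..<2} d"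
    using in_Linf_bound[of "{1<..<2}" d] by auto
  define C where "C = (1 + 123 * B) / sqrt (\<delta> * min (\<delta> / 2) (\<beta>\<^sup>2 / 2)) + 41"
  have C: "C > 0"
    unfolding C_def using B0 assms(5,7) by (intro add_nonneg_pos) auto
  show ?thesis
  proof (intro exI[of _ C] conjI C allI impI)
    fix \<epsilon> :: real and f \<Phi> \<alpha>\<^sub>1 \<alpha>\<^sub>2 \<alpha>\<^sub>3 \<beta>\<^sub>1 \<beta>\<^sub>2 \<beta>\<^sub>3 \<delta>\<^sub>1 \<delta>\<^sub>2 u\<^sub>1 u\<^sub>2
    assume \<epsilon>: "\<epsilon> > 0" and f: "in_Linf {0<..<2} f" and \<Phi>: "admissible_history \<Phi>"
      and sol: "solves_shift_system \<epsilon> b c d f \<Phi> u\<^sub>1 u\<^sub>2"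
      and bc: "boundary_conditions \<alpha>\<^sub>1 \<alpha>\<^sub>2 \<alpha>\<^sub>3 \<beta>\<^sub>1 \<beta>\<^sub>2 \<beta>\<^sub>3 \<delta>\<^sub>1 \<delta>\<^sub>2 u\<^sub>1 u\<^sub>2"
      and mc: "matching_conditions u\<^sub>1 u\<^sub>2"
    have \<Phi>: "in_Linf {-1<..<0} \<Phi>" using \<Phi> by (simp add: admissible_history_def)
    obtain N\<^sub>f where N\<^sub>f: "negligible N\<^sub>f" "\<And>x. x \<in> {0<..<2} - N\<^sub>f \<Longrightarrow> \<bar>f x\<bar> \<le> Linf_norm {0<..<2} f"
      using in_Linf_bound[OF f] by auto
    obtain N\<^sub>\<Phi> where N\<^sub>\<Phi>: "negligible N\<^sub>\<Phi>" "\<And>x. x \<in> {-1<..<0} - N\<^sub>\<Phi> \<Longrightarrow> \<bar>\<Phi> x\<bar> \<le> Linf_norm {-1<..<0} \<Phi>"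
      using in_Linf_bound[OF \<Phi>] by auto
    have nonneg: "Linf_norm {0<..<2} f \<ge> 0" "Linf_norm {-1<..<0} \<Phi> \<ge> 0"
      using f \<Phi> by (auto intro!: Linf_norm_nonneg simp: open_not_negligible)
    define T where "T = Linf_norm {0<..<2} f + \<bar>\<alpha>\<^sub>1\<bar> + \<bar>\<alpha>\<^sub>3\<bar> + \<bar>\<delta>\<^sub>1\<bar> + \<bar>\<delta>\<^sub>2\<bar> + \<bar>\<beta>\<^sub>1\<bar> + \<bar>\<beta>\<^sub>3\<bar>
      + Linf_norm {-1<..<0} \<Phi>"
    have T: "T \<ge> 0" unfolding T_def using nonneg by simp
    have bound: "\<bar>u\<^sub>1 x\<bar> \<le> C * T" "\<bar>u\<^sub>2 (x + 1)\<bar> \<le> C * T" if "x \<in> {0<..<1}" for x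
      unfolding C_def T_def
      using shift_system_bound[OF \<epsilon> assms(5) assms(7) b'(2) B bspec[OF assms(4)] bspec[OF assms(6)]
          N\<^sub>b(1) N\<^sub>d(1) N\<^sub>f(1) N\<^sub>\<Phi>(1) N\<^sub>b(2) N\<^sub>d(2) N\<^sub>f(2) nonneg(1) N\<^sub>\<Phi>(2) nonneg(2) sol bc mc that]
      by blast+
    \<comment> \<open>The point 1 is left out because \<open>u\<^sub>2 1\<close> is arbitrary; a
      single point does not affect the norm.\<close>
    have glue_le: "\<bar>glue u\<^sub>1 u\<^sub>2 x\<bar> \<le> C * T" if "x \<in> {0<..<2} - {1}" for x
    proof (cases "x < 1")
      case True
      then show ?thesis using bound(1)[of x] that by (simp add: glue_def)
    next
      case False
      then show ?thesis using bound(2)[of "x - 1"] that by (simp add: glue_def)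
    qed
    have diff: "\<forall>x\<in>{0<..<1}. u\<^sub>1 differentiable at x" "\<forall>x\<in>{1<..<2}. u\<^sub>2 differentiable at x"
      using sol unfolding solves_shift_system_def four_times_differentiable_on_def by fastforce+
    then have "continuous_on {0<..<1} u\<^sub>1" "continuous_on {1<..<2} u\<^sub>2"
      by (auto intro!: differentiable_imp_continuous_on differentiable_at_imp_differentiable_on)
    then have meas: "glue u\<^sub>1 u\<^sub>2 \<in> borel_measurable (lebesgue_on {0<..<2})"
      by (rule glue_measurable)
    have CT: "C * T \<ge> 0" using C T by simp
    show "in_Linf {0<..<2} (glue u\<^sub>1 u\<^sub>2)"
      by (rule in_LinfI(1)[OF meas _ negligible_sing[of 1] glue_le CT]) auto
    show "Linf_norm {0<..<2} (glue u\<^sub>1 u\<^sub>2)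
        \<le> C * (Linf_norm {0<..<2} f + \<bar>\<alpha>\<^sub>1\<bar> + \<bar>\<alpha>\<^sub>3\<bar> + \<bar>\<delta>\<^sub>1\<bar> + \<bar>\<delta>\<^sub>2\<bar> + \<bar>\<beta>\<^sub>1\<bar> + \<bar>\<beta>\<^sub>3\<bar>
               + Linf_norm {-1<..<0} \<Phi>)"
      using in_LinfI(2)[OF meas _ negligible_sing[of 1] glue_le CT] unfolding T_def by simp
  qed
qed

end
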